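(* Let $0<\alpha<1$, $\theta>0$, and let $\eta$ be a finite non-atomic measure on a Polish space $\mathcal{Y}$ with $\eta(\mathcal{Y})>0$; put $H=\eta/\eta(\mathcal{Y})$ and $K=\eta(\mathcal{Y})/\alpha$. Then: (i) $$\mathcal{PD}_{\alpha,\theta}(d\mu|\eta)=\int_0^\infty\mathcal{P}(d\mu|\rho_{\alpha,L^{1/\alpha}},\eta)\,\mathcal{G}(dL|\theta/\alpha,K);$$ that is, given $L$, $\mu$ is a generalized gamma random measure with Lévy measure $\rho_{\alpha,L^{1/\alpha}}(ds)\eta(dy)$, and $L$ is a gamma random variable with parameters $(\theta/\alpha,K)$. When $K=1$ and $\theta=\alpha$, $L$ is standard exponential. For non-negative measurable $g$ the Laplace functional is $$\int e^{-\mu(g)}\mathcal{PD}_{\alpha,\theta}(d\mu|\eta)=\int_0^\infty\mathcal{L}_\mu(g|L,\alpha)\,\mathcal{G}(dL|\theta/\alpha,K),\qquad\mathcal{L}_\mu(g|L,\alpha)=e^{-\frac1\alpha\int_{\mathcal{Y}}(g(y)+L^{1/\alpha})^\alpha\eta(dy)}e^{KL},$$ $\mathcal{L}_\mu(g|L,\alpha)$ being the conditional Laplace functional of $\mu$ given $L$. (ii) Writing $\mu_L$ for $\mu$ conditioned on $L$, the unconditional law of $L^{1/\alpha}\mu_L$ is given by its Laplace functional $$E\big[e^{-L^{1/\alpha}\mu_L(g)}\big]=\int_0^\infty\mathcal{L}_\mu(L^{1/\alpha}g|L,\alpha)\,\mathcal{G}(dL|\theta/\alpha,K)=\left[\int_{\mathcal{Y}}(g(y)+1)^\alpha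 H(dy)\right]^{-\theta/\alpha}.$$ (iii) Consequently $L^{1/\alpha}T_L$, where $T_L=\mu_L(\mathcal{Y})$, has the gamma distribution with shape $\theta$ and rate $1$.
   Context: $\mathcal{G}(dL|a,b)$ is the gamma law with shape $a$ and rate $b$. For $b\ge0$, $\rho_{\alpha,b}(ds)=\frac{1}{\Gamma(1-\alpha)}s^{-\alpha-1}e^{-bs}ds$ on $(0,\infty)$ and $\rho_\alpha=\rho_{\alpha,0}$. $\mathcal{P}(d\mu|\rho,\eta)$ is the law of $\mu(dy)=\int_0^\infty sN(ds,dy)$ with $N$ a Poisson random measure on $(0,\infty)\times\mathcal{Y}$ with intensity $\rho(ds)\eta(dy)$; $T=\mu(\mathcal{Y})$; $\mu(g)=\int g\,d\mu$. $\mathcal{PD}_{\alpha,\theta}(d\mu|\eta)=T^{-\theta}\mathcal{P}(d\mu|\rho_\alpha,\eta)/\int T^{-\theta}\mathcal{P}(d\mu|\rho_\alpha,\eta)$. *)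

theory Defs
  imports "HOL-Probability.Probability"
begin

text \<open>
  The space of all (not necessarily finite) measures on the measurable space \<open>K\<close>, with the
  \<open>\<sigma>\<close>-algebra generated by the evaluations at measurable sets.  It is the analogue of
  \<^const>\<open>subprob_algebra\<close> without the restriction to sub-probability measures.
\<close>

definition meas_algebra :: "'a measure \<Rightarrow> 'a measure measure" where
  "meas_algebra K =
    (SUP A \<in> sets K. vimage_algebra {M. sets M = sets K} (\<lambda>M. emeasure M A) borel)"

text \<open>
  A law of a Poisson random measure with intensity \<open>\<nu>\<close>.  On sets of infinite intensity the
  Poisson law is the point mass at \<open>\<infinity>\<close>; for intensity zero, \<open>0 ^ 0 = 1\<close> gives the point mass at 0.
\<close>

definition is_prm_law :: "'a measure \<Rightarrow> 'a measure measure \<Rightarrow> bool" where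
  "is_prm_law \<nu> P \<longleftrightarrow>
     prob_space P \<and> sets P = sets (meas_algebra \<nu>) \<and>
     (\<forall>A \<in> sets \<nu>. emeasure \<nu> A < \<infinity> \<longrightarrow>
        (\<forall>k. emeasure P {N \<in> space P. emeasure N A = of_nat k}
               = ennreal (measure \<nu> A ^ k / fact k * exp (- measure \<nu> A)))) \<and>
     (\<forall>A \<in> sets \<nu>. emeasure \<nu> A = \<infinity> \<longrightarrow> (AE N in P. emeasure N A = \<infinity>)) \<and>
     (\<forall>(n::nat) A. disjoint_family_on A {..<n} \<and> (\<forall>i<n. A i \<in> sets \<nu>) \<longrightarrow>
        prob_space.indep_vars P (\<lambda>_. borel) (\<lambda>i N. emeasure N (A i)) {..<n})"

text \<open>For \<open>\<sigma>\<close>-finite \<open>\<nu>\<close> there is exactly one such law.\<close>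

definition prm_law :: "'a measure \<Rightarrow> 'a measure measure" where
  "prm_law \<nu> = (THE P. is_prm_law \<nu> P)"

text \<open>
  The law \<open>\<P>(d\<mu>|\<rho>,\<eta>)\<close> of \<open>\<mu>(dy) = \<integral> s N(ds,dy)\<close>.  The L\'evy measure \<open>\<rho>\<close> on \<open>(0,\<infinity>)\<close> is regarded
  as a measure on the real line that vanishes on \<open>{..0}\<close>.
\<close>

definition jump_integral :: "(real \<times> 'y::topological_space) measure \<Rightarrow> 'y measure" where
  "jump_integral N = distr (density N (\<lambda>(s, y). ennreal s)) borel snd"

definition crm_law :: "real measure \<Rightarrow> 'y::topological_space measure \<Rightarrow> 'y measure measure" where
  "crm_law \<rho> \<eta> = distr (prm_law (\<rho> \<Otimes>\<^sub>M \<eta>)) (meas_algebra borel) jump_integral"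

definition gg_levy :: "real \<Rightarrow> real \<Rightarrow> real measure" where
  "gg_levy \<alpha> b = density lborel
     (\<lambda>s. if 0 < s then ennreal (1 / Gamma (1 - \<alpha>) * s powr (- \<alpha> - 1) * exp (- b * s)) else 0)"

definition gamma_law :: "real \<Rightarrow> real \<Rightarrow> real measure" where
  "gamma_law a b = density lborel
     (\<lambda>x. if 0 < x then ennreal (b powr a / Gamma a * x powr (a - 1) * exp (- b * x)) else 0)"

text \<open>Real powers and \<open>e\<^sup>-\<^sup>x\<close> on \<open>[0,\<infinity>]\<close>, with the limiting values at \<open>0\<close> and \<open>\<infinity>\<close>.\<close>

definition ennreal_powr :: "ennreal \<Rightarrow> real \<Rightarrow> ennreal" where
  "ennreal_powr x a =
     (if a = 0 then 1
      else if x = 0 then (if a < 0 then \<infinity> else 0)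
      else if x = \<infinity> then (if a < 0 then 0 else \<infinity>)
      else ennreal (enn2real x powr a))"

definition ennreal_exp_neg :: "ennreal \<Rightarrow> ennreal" where
  "ennreal_exp_neg x = (if x = \<infinity> then 0 else ennreal (exp (- enn2real x)))"

definition total_mass :: "'y measure \<Rightarrow> ennreal" where
  "total_mass \<mu> = emeasure \<mu> (space \<mu>)"

definition PD_law :: "real \<Rightarrow> real \<Rightarrow> 'y::topological_space measure \<Rightarrow> 'y measure measure" where
  "PD_law \<alpha> \<theta> \<eta> =
     density (crm_law (gg_levy \<alpha> 0) \<eta>)
       (\<lambda>\<mu>. ennreal_powr (total_mass \<mu>) (- \<theta>)
             / (\<integral>\<^sup>+ \<mu>. ennreal_powr (total_mass \<mu>) (- \<theta>) \<partial>crm_law (gg_levy \<alpha> 0) \<eta>))"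

definition laplace_functional :: "'y measure measure \<Rightarrow> ('y \<Rightarrow> real) \<Rightarrow> ennreal" where
  "laplace_functional Q g = (\<integral>\<^sup>+ \<mu>. ennreal_exp_neg (\<integral>\<^sup>+ y. ennreal (g y) \<partial>\<mu>) \<partial>Q)"

text \<open>
  \<open>gg_kernel\<close> is the law of \<open>\<mu>\<close> given \<open>L\<close> and \<open>joint_law\<close> that of the pair \<open>(L, \<mu>)\<close> with
  \<open>L\<close> gamma distributed.
\<close>

definition gg_kernel :: "real \<Rightarrow> 'y::topological_space measure \<Rightarrow> real \<Rightarrow> 'y measure measure" where
  "gg_kernel \<alpha> \<eta> L = crm_law (gg_levy \<alpha> (L powr (1 / \<alpha>))) \<eta>"

definition joint_law ::
  "real \<Rightarrow> real \<Rightarrow> real \<Rightarrow> 'y::topological_space measure \<Rightarrow> (real \<times> 'y measure) measure" where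
  "joint_law \<alpha> \<theta> K \<eta> =
     gamma_law (\<theta> / \<alpha>) K \<bind>
       (\<lambda>L. distr (gg_kernel \<alpha> \<eta> L) (borel \<Otimes>\<^sub>M meas_algebra borel) (\<lambda>\<mu>. (L, \<mu>)))"

text \<open>\<open>\<L>\<^sub>\<mu>(g|L,\<alpha>)\<close>, where \<open>K = \<eta>(\<Y>)/\<alpha>\<close>; the \<open>\<eta>\<close>-integral may be infinite.\<close>

definition cond_laplace ::
  "real \<Rightarrow> real \<Rightarrow> 'y measure \<Rightarrow> ('y \<Rightarrow> real) \<Rightarrow> real \<Rightarrow> ennreal" where
  "cond_laplace \<alpha> K \<eta> g L =
     ennreal_exp_neg (ennreal (1 / \<alpha>) * (\<integral>\<^sup>+ y. ennreal ((g y + L powr (1 / \<alpha>)) powr \<alpha>) \<partial>\<eta>))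
       * ennreal (exp (K * L))"

definition nonatomic :: "'y measure \<Rightarrow> bool" where
  "nonatomic \<eta> \<longleftrightarrow>
     (\<forall>A \<in> sets \<eta>. 0 < emeasure \<eta> A \<longrightarrow>
        (\<exists>B \<in> sets \<eta>. B \<subseteq> A \<and> 0 < emeasure \<eta> B \<and> emeasure \<eta> B < emeasure \<eta> A))"

end

theory Submission
  imports Defs
begin

text \<open>
  Laws on \<^const>\<open>meas_algebra\<close> are determined by their Laplace functionals: starting from
  \<open>exp(-\<mu>(g))\<close> one exchanges exponential factors for indicators of \<open>\<mu>(A) \<in> B\<close> one at a time, each
  exchange being the uniqueness of the Laplace transform on \<open>[0,\<infinity>]\<close> (a moment problem in
  \<open>exp(-x)\<close>).  The same exchange shows that the Poisson random measure is characterised by the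
  functional \<open>exp(-\<integral>(1-e\<^sup>-\<^sup>g) d\<nu>)\<close>, which the usual construction from Poisson many points in each
  cell of a partition possesses.  Since \<open>\<integral>(1-e\<^sup>-\<^sup>s\<^sup>g) \<rho>\<^sub>b(ds) = ((g+b)\<^sup>\<alpha>-b\<^sup>\<alpha>)/\<alpha>\<close>, comparing Laplace
  functionals shows that \<open>\<P>(\<rho>\<^sub>b,\<eta>)\<close> has density \<open>exp(K b\<^sup>\<alpha> - b T)\<close> with respect to \<open>\<P>(\<rho>\<^sub>0,\<eta>)\<close>.
  Mixing over \<open>b = L\<^sup>1\<^sup>/\<^sup>\<alpha>\<close> turns this density into a constant multiple of \<open>T\<^sup>-\<^sup>\<theta>\<close> by scaling in \<open>L\<close>;
  the constant need not be computed because the mixture has total mass one.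
\<close>

section \<open>Laplace transforms on the extended half-line\<close>

text \<open>All quantities live in \<open>ennreal\<close>: \<open>mu(g)\<close> may be infinite, and
  the total mass \<open>T\<close> is never shown to be almost surely positive and finite beforehand.
  Each identity is proved at 0 and at \<open>\<infinity>\<close> as well, and finiteness of the
  normalising integral of \<open>PD_law\<close> comes out at the end. The exchange of factors can be
  iterated because multiplying \<open>exp(-mu(g))\<close> by \<open>exp(-n mu(A))\<close> only
  replaces \<open>g\<close> by \<open>g + n 1_A\<close>: a hypothesis about all \<open>g\<close>
  supplies the whole transform of \<open>mu(A)\<close> under any weight built so far. Since
  \<open>prm_law\<close> is a definite description, nothing can be said about \<open>crm_law\<close>
  before existence and uniqueness of the Poisson law are both settled. The gamma parameters are
  forced. With \<open>b = L^(1/\<alpha>)\<close> the tilting constant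
  \<open>exp(K b^\<alpha>)\<close> is \<open>exp(K L)\<close>, which rate \<open>K\<close> cancels
  exactly; the remaining \<open>L^(\<theta>/\<alpha> - 1) exp(-L^(1/\<alpha>) T) dL\<close> is
  homogeneous in \<open>T\<close> of degree \<open>-\<theta>\<close> thanks to shape
  \<open>\<theta>/\<alpha>\<close>.\<close>

lemma ennreal_exp_neg_simps [simp]:
  "ennreal_exp_neg 0 = 1" "ennreal_exp_neg \<infinity> = 0" "ennreal_exp_neg \<top> = 0"
  by (simp_all add: ennreal_exp_neg_def)

lemma ennreal_exp_neg_ennreal: "0 \<le> r \<Longrightarrow> ennreal_exp_neg (ennreal r) = ennreal (exp (- r))"
  by (simp add: ennreal_exp_neg_def)

lemma ennreal_exp_neg_le_1: "ennreal_exp_neg x \<le> 1"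
  by (cases x) (auto simp: ennreal_exp_neg_ennreal)

lemma ennreal_exp_neg_neq_top [simp]: "ennreal_exp_neg x \<noteq> \<top>" "ennreal_exp_neg x \<noteq> \<infinity>"
  by (auto simp: ennreal_exp_neg_def)

lemma ennreal_exp_neg_less_top [simp]: "ennreal_exp_neg x < \<top>"
  by (auto simp: ennreal_exp_neg_def)

lemma ennreal_exp_neg_eq_0_iff: "ennreal_exp_neg x = 0 \<longleftrightarrow> x = \<infinity>"
  by (auto simp: ennreal_exp_neg_def ennreal_eq_0_iff not_le)

lemma ennreal_exp_neg_eq_1_iff: "ennreal_exp_neg x = 1 \<longleftrightarrow> x = 0"
  by (cases x) (auto simp: ennreal_exp_neg_ennreal)

lemma ennreal_exp_neg_add: "ennreal_exp_neg (x + y) = ennreal_exp_neg x * ennreal_exp_neg y"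
  by (cases x; cases y)
    (auto simp: ennreal_exp_neg_ennreal simp flip: ennreal_plus ennreal_mult exp_add)

lemma ennreal_exp_neg_sum: "ennreal_exp_neg (\<Sum>i\<in>I. f i) = (\<Prod>i\<in>I. ennreal_exp_neg (f i))"
  by (induction I rule: infinite_finite_induct) (auto simp: ennreal_exp_neg_add)

lemma ennreal_exp_neg_antimono: "x \<le> y \<Longrightarrow> ennreal_exp_neg y \<le> ennreal_exp_neg x"
  by (cases x; cases y) (auto simp: ennreal_exp_neg_ennreal top_unique ennreal_leI)

lemma ennreal_exp_neg_of_nat_mult: "ennreal_exp_neg (of_nat n * x) = ennreal_exp_neg x ^ n"
  by (induction n) (auto simp: ennreal_exp_neg_add distrib_right)

lemma borel_measurable_ennreal_exp_neg [measurable]: "ennreal_exp_neg \<in> borel_measurable borel"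
  unfolding ennreal_exp_neg_def[abs_def] by measurable

text \<open>Continuity holds at \<open>\<infinity>\<close> too, so limits of possibly infinite
  integrals pass through the exponential without a finiteness assumption.\<close>

lemma tendsto_ennreal_exp_neg:
  assumes "(X \<longlongrightarrow> x) F"
  shows "((\<lambda>n. ennreal_exp_neg (X n)) \<longlongrightarrow> ennreal_exp_neg x) F"
proof (cases "x = \<top>")
  case False
  then have x: "x < \<top>" by (simp add: less_top)
  have ev: "\<forall>\<^sub>F n in F. X n < \<top>"
    using order_tendstoD(2)[OF assms x] .
  have "((\<lambda>n. enn2real (X n)) \<longlongrightarrow> enn2real x) F"
    using assms x by (intro tendsto_enn2real) auto
  then have "((\<lambda>n. ennreal (exp (- enn2real (X n)))) \<longlongrightarrow> ennreal (exp (- enn2real x))) F"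
    by (intro tendsto_ennrealI tendsto_exp tendsto_minus)
  moreover have "\<forall>\<^sub>F n in F. ennreal (exp (- enn2real (X n))) = ennreal_exp_neg (X n)"
    using ev by eventually_elim (auto simp: ennreal_exp_neg_def)
  ultimately have "((\<lambda>n. ennreal_exp_neg (X n)) \<longlongrightarrow> ennreal (exp (- enn2real x))) F"
    by (rule Lim_transform_eventually)
  then show ?thesis
    using False by (simp only: ennreal_exp_neg_def[of x] if_False infinity_ennreal_def)
next
  case True
  show ?thesis
  proof (rule order_tendstoI)
    fix a assume "ennreal_exp_neg x < a"
    then obtain b where b: "0 < b" "b < a"
      using True dense[of 0 a] by auto
    then obtain e where e: "0 < e" "ennreal e < a"
      by (cases b) (auto intro: that)
    have "\<forall>\<^sub>F n in F. ennreal (max 0 (- ln e)) < X n"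
      using assms True by (intro order_tendstoD) auto
    then show "\<forall>\<^sub>F n in F. ennreal_exp_neg (X n) < a"
    proof eventually_elim
      case (elim n)
      have "ennreal_exp_neg (X n) \<le> ennreal_exp_neg (ennreal (max 0 (- ln e)))"
        using elim by (intro ennreal_exp_neg_antimono) auto
      also have "\<dots> = ennreal (exp (- max 0 (- ln e)))"
        by (rule ennreal_exp_neg_ennreal) simp
      also have "\<dots> \<le> ennreal e"
      proof (rule ennreal_leI)
        have "exp (- max 0 (- ln e)) \<le> exp (ln e)" by (subst exp_le_cancel_iff) auto
        then show "exp (- max 0 (- ln e)) \<le> e" using e by simp
      qed
      finally show ?case using e by simp
    qed
  qed (use True in auto)
qed

section \<open>The sigma-algebra generated by evaluations\<close>

lemma space_meas_algebra: "space (meas_algebra K) = {M. sets M = sets K}"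
  using sets.top[of K] by (auto simp add: meas_algebra_def space_Sup_eq_UN simp del: sets.top)

lemma meas_algebra_cong: "sets M = sets N \<Longrightarrow> meas_algebra M = meas_algebra N"
  by (simp add: meas_algebra_def)

lemma measurable_emeasure_meas_algebra [measurable]:
  "A \<in> sets K \<Longrightarrow> (\<lambda>M. emeasure M A) \<in> borel_measurable (meas_algebra K)"
  by (auto intro!: measurable_Sup1 measurable_vimage_algebra1 simp: meas_algebra_def)

lemma measurable_meas_algebra:
  "(\<And>x. x \<in> space M \<Longrightarrow> sets (f x) = sets K) \<Longrightarrow>
   (\<And>A. A \<in> sets K \<Longrightarrow> (\<lambda>x. emeasure (f x) A) \<in> borel_measurable M) \<Longrightarrow>
   f \<in> M \<rightarrow>\<^sub>M meas_algebra K"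
  by (auto intro!: measurable_Sup2 measurable_vimage_algebra2 simp: meas_algebra_def)

lemma nn_integral_measurable_meas_algebra [measurable]:
  assumes "f \<in> borel_measurable K"
  shows "(\<lambda>M. \<integral>\<^sup>+x. f x \<partial>M) \<in> borel_measurable (meas_algebra K)"
proof -
  \<comment> \<open>The algebraic rules for the integral need the integrand to be measurable for
    \<open>M\<close>, hence hold only for \<open>M\<close> in the space of
    \<open>meas_algebra K\<close>; each induction step is therefore transferred from a function
    \<open>F\<close> that agrees with the integral there.\<close>
  have by_cong: "(\<lambda>M. \<integral>\<^sup>+x. h x \<partial>M) \<in> borel_measurable (meas_algebra K)"
    if "F \<in> borel_measurable (meas_algebra K)" "\<And>M. sets M = sets K \<Longrightarrow> (\<integral>\<^sup>+x. h x \<partial>M) = F M" for h F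
    using that measurable_cong[of "meas_algebra K" "\<lambda>M. \<integral>\<^sup>+x. h x \<partial>M" F borel]
    by (auto simp: space_meas_algebra)
  show ?thesis
    using assms
  proof (induction rule: borel_measurable_induct)
    case (cong f g)
    show ?case
      by (rule by_cong[OF cong(4)]) (auto dest: sets_eq_imp_space_eq simp: cong(3) intro!: nn_integral_cong)
  next
    case (set A)
    then show ?case by (intro by_cong[OF measurable_emeasure_meas_algebra[OF set]]) simp
  next
    case (mult u c)
    have "(\<lambda>M. c * (\<integral>\<^sup>+x. u x \<partial>M)) \<in> borel_measurable (meas_algebra K)" using mult by simp
    then show ?case
      by (rule by_cong) (use mult in \<open>auto intro!: nn_integral_cmult cong: measurable_cong_sets\<close>)
  next
    case (add u v)
    have "(\<lambda>M. (\<integral>\<^sup>+x. v x \<partial>M) + (\<integral>\<^sup>+x. u x \<partial>M)) \<in> borel_measurable (meas_algebra K)" using add by simp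
    then show ?case
      by (rule by_cong) (use add in \<open>auto intro!: nn_integral_add cong: measurable_cong_sets\<close>)
  next
    case (seq U)
    have "(\<lambda>M. SUP i. \<integral>\<^sup>+x. U i x \<partial>M) \<in> borel_measurable (meas_algebra K)" using seq by simp
    then show ?case
      unfolding SUP_apply
      by (rule by_cong)
        (use seq in \<open>auto intro!: nn_integral_monotone_convergence_SUP cong: measurable_cong_sets\<close>)
  qed
qed

section \<open>From moments to transforms at the natural numbers\<close>

text \<open>On \<open>[-1,1]\<close> the terms of the series of \<open>exp(itx)\<close> are bounded
  by the summable \<open>|t|^n / n!\<close>. Integrating term by term writes the characteristic
  function as a power series in the moments.\<close>

lemma real_distribution_eq_moments:
  fixes M N :: "real measure"
  assumes M: "real_distribution M" and N: "real_distribution N"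
    and bdM: "AE x in M. \<bar>x\<bar> \<le> 1" and bdN: "AE x in N. \<bar>x\<bar> \<le> 1"
    and eq: "\<And>n. (\<integral>x. x ^ n \<partial>M) = (\<integral>x. x ^ n \<partial>N)"
  shows "M = N"
proof (rule Levy_uniqueness[OF M N])
  have char: "char D t = (\<Sum>n. (\<i> * t) ^ n / fact n * (\<integral>x. x ^ n \<partial>D))"
    if D: "real_distribution D" and bd: "AE x in D. \<bar>x\<bar> \<le> 1" for D :: "real measure" and t
  proof -
    interpret D: real_distribution D by fact
    let ?f = "\<lambda>n x. (\<i> * t) ^ n / fact n * complex_of_real (x ^ n)"
    have int: "integrable D (\<lambda>x. x ^ n)" for n :: nat
      by (rule D.integrable_const_bound[of _ 1])
        (use bd in \<open>auto simp: power_abs power_le_one elim!: eventually_mono\<close>)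
    have intc: "integrable D (?f n)" for n
      using int by (intro integrable_mult_right integrable_of_real)
    have sm: "summable (\<lambda>n. \<bar>t\<bar> ^ n / fact n)"
      using summable_exp[of "\<bar>t\<bar>"] by (simp add: field_simps)
    have "char D t = (\<integral>x. (\<Sum>n. ?f n x) \<partial>D)"
      unfolding char_def
    proof (intro Bochner_Integration.integral_cong refl)
      fix x show "iexp (t * x) = (\<Sum>n. ?f n x)"
        unfolding exp_def
        by (intro suminf_cong) (simp add: power_mult_distrib scaleR_conv_of_real field_simps)
    qed
    also have "\<dots> = (\<Sum>n. \<integral>x. ?f n x \<partial>D)"
    proof (rule integral_suminf[OF intc])
      have nb: "AE x in D. norm (?f n x) \<le> \<bar>t\<bar> ^ n / fact n" for n
        using bd
      proof eventually_elim
        case (elim x)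
        then have "\<bar>x\<bar> ^ n \<le> 1" by (intro power_le_one) auto
        then have "\<bar>t\<bar> ^ n / fact n * \<bar>x\<bar> ^ n \<le> \<bar>t\<bar> ^ n / fact n"
          by (intro mult_left_le) auto
        then show ?case by (simp add: norm_mult norm_divide norm_power)
      qed
      have "AE x in D. \<forall>n. norm (?f n x) \<le> \<bar>t\<bar> ^ n / fact n"
        using nb by (simp add: AE_all_countable)
      then show "AE x in D. summable (\<lambda>n. norm (?f n x))"
        by eventually_elim (rule summable_comparison_test'[OF sm, of 0], simp)
      have "(\<integral>x. norm (?f n x) \<partial>D) \<le> \<bar>t\<bar> ^ n / fact n" for n
        by (rule order_trans[OF integral_mono_AE[OF integrable_norm[OF intc] D.integrable_const nb]])
          (simp add: D.prob_space[simplified])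
      then show "summable (\<lambda>n. \<integral>x. norm (?f n x) \<partial>D)"
        by (intro summable_comparison_test'[OF sm, of 0]) simp
    qed
    also have "\<dots> = (\<Sum>n. (\<i> * t) ^ n / fact n * (\<integral>x. x ^ n \<partial>D))"
      by (simp del: of_real_power)
    finally show ?thesis .
  qed
  show "char M = char N"
    by (rule ext) (simp add: char[OF M bdM] char[OF N bdN] eq)
qed

lemma prob_eq_laplace_nat:
  fixes M N :: "ennreal measure"
  assumes M: "prob_space M" "sets M = sets borel" and N: "prob_space N" "sets N = sets borel"
    and eq: "\<And>n::nat. (\<integral>\<^sup>+x. ennreal_exp_neg (of_nat n * x) \<partial>M) = (\<integral>\<^sup>+x. ennreal_exp_neg (of_nat n * x) \<partial>N)"
  shows "M = N"
proof -
  define u where "u = (\<lambda>x. enn2real (ennreal_exp_neg x))"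
  \<comment> \<open>\<open>v\<close> is a left inverse of \<open>u\<close>, so the image law under
    \<open>u\<close> determines the original one. Sending 0 to \<open>\<infinity>\<close> recovers a
    possible atom at \<open>\<infinity>\<close>.\<close>
  define v where "v = (\<lambda>r. if r \<le> 0 then \<infinity> else ennreal (- ln r))"
  have [measurable]: "u \<in> borel_measurable borel" "v \<in> borel_measurable borel"
    unfolding u_def v_def by measurable
  have u01: "0 \<le> u x" "u x \<le> 1" for x
    using ennreal_exp_neg_le_1[of x] by (auto simp: u_def intro: enn2real_leI)
  have vu: "v (u x) = x" for x
    by (cases x) (auto simp: u_def v_def ennreal_exp_neg_ennreal not_le)
  have un: "ennreal (u x ^ n) = ennreal_exp_neg (of_nat n * x)" for n x
    by (simp add: u_def ennreal_exp_neg_of_nat_mult flip: ennreal_power)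
  have distr: "real_distribution (distr D borel u)" "AE x in distr D borel u. \<bar>x\<bar> \<le> 1"
    "(\<integral>x. x ^ n \<partial>distr D borel u) = enn2real (\<integral>\<^sup>+x. ennreal_exp_neg (of_nat n * x) \<partial>D)"
    "distr (distr D borel u) borel v = D"
    if D: "prob_space D" "sets D = sets borel" for D n
  proof -
    interpret prob_space D by fact
    have [measurable_cong]: "sets D = sets borel" by fact
    have [measurable]: "u \<in> D \<rightarrow>\<^sub>M borel" by measurable
    show "real_distribution (distr D borel u)"
      by (intro real_distribution_distr) simp
    show "AE x in distr D borel u. \<bar>x\<bar> \<le> 1"
      using u01 by (subst AE_distr_iff) auto
    show "(\<integral>x. x ^ n \<partial>distr D borel u) = enn2real (\<integral>\<^sup>+x. ennreal_exp_neg (of_nat n * x) \<partial>D)"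
    proof -
      have "(\<integral>x. x ^ n \<partial>distr D borel u) = (\<integral>x. u x ^ n \<partial>D)"
        by (subst integral_distr) auto
      also have "\<dots> = enn2real (\<integral>\<^sup>+x. ennreal (u x ^ n) \<partial>D)"
        using u01 by (intro integral_eq_nn_integral) auto
      finally show ?thesis by (simp only: un)
    qed
    have "distr (distr D borel u) borel v = distr D borel (v \<circ> u)"
      by (rule distr_distr) auto
    also have "v \<circ> u = (\<lambda>x. x)" using vu by auto
    also have "distr D borel (\<lambda>x. x) = D" by (rule distr_id2) (simp add: D)
    finally show "distr (distr D borel u) borel v = D" .
  qed
  have "distr M borel u = distr N borel u"
    using distr[OF M] distr[OF N] eq by (intro real_distribution_eq_moments) auto
  then show ?thesis
    using distr(4)[OF M] distr(4)[OF N] by metis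
qed

text \<open>The case \<open>n = 0\<close> says that the total masses agree, so \<open>N\<close> is
  finite as well. Unless the mass is zero, both measures are normalised and the probability case
  applies.\<close>

lemma finite_measure_eq_laplace_nat:
  fixes M N :: "ennreal measure"
  assumes M: "finite_measure M" "sets M = sets borel" and N: "sets N = sets borel"
    and eq: "\<And>n::nat. (\<integral>\<^sup>+x. ennreal_exp_neg (of_nat n * x) \<partial>M) = (\<integral>\<^sup>+x. ennreal_exp_neg (of_nat n * x) \<partial>N)"
  shows "M = N"
proof -
  interpret M: finite_measure M by fact
  have [simp]: "space M = UNIV" "space N = UNIV"
    using M N by (auto dest: sets_eq_imp_space_eq)
  define c where "c = emeasure M UNIV"
  have c: "emeasure M UNIV = c" "emeasure N UNIV = c" "c \<noteq> \<top>"
    using eq[of 0] M.finite_emeasure_space by (auto simp: c_def)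
  show ?thesis
  proof (cases "c = 0")
    case True
    show ?thesis
    proof (rule measure_eqI)
      fix A assume "A \<in> sets M"
      then show "emeasure M A = emeasure N A"
        using c True emeasure_mono[of A UNIV M] emeasure_mono[of A UNIV N] M N by auto
    qed (simp add: M N)
  next
    case False
    have cc: "c * (1 / c) = 1" "1 / c * c = 1"
      using c False by (simp_all add: ennreal_times_divide ennreal_divide_self mult.commute less_top)
    have sc: "scale_measure c (scale_measure (1 / c) D) = D" for D :: "ennreal measure"
      by (simp add: cc)
    have "scale_measure (1 / c) M = scale_measure (1 / c) N"
    proof (rule prob_eq_laplace_nat)
      show "prob_space (scale_measure (1 / c) M)" "prob_space (scale_measure (1 / c) N)"
        by (auto intro!: prob_spaceI simp: space_scale_measure c cc)
      fix n :: nat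
      have [measurable]: "(\<lambda>x. ennreal_exp_neg (of_nat n * x)) \<in> borel_measurable M"
          "(\<lambda>x. ennreal_exp_neg (of_nat n * x)) \<in> borel_measurable N"
        by (simp_all add: measurable_cong_sets[OF M(2) refl] measurable_cong_sets[OF N refl])
      show "(\<integral>\<^sup>+x. ennreal_exp_neg (of_nat n * x) \<partial>scale_measure (1 / c) M)
          = (\<integral>\<^sup>+x. ennreal_exp_neg (of_nat n * x) \<partial>scale_measure (1 / c) N)"
        by (simp add: nn_integral_scale_measure eq)
    qed (simp_all add: M N)
    then show ?thesis by (metis sc)
  qed
qed

section \<open>Uniqueness of Laplace functionals\<close>

text \<open>One exchange of an exponential factor for an indicator: the hypothesis identifies the
  law of \<open>X\<close> under the weighted measure \<open>density R F\<close> with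
  \<open>\<mu>\<close>. The bound on \<open>F\<close> keeps the weighted measure finite.\<close>

lemma nn_integral_weight_indicator_eqI:
  fixes \<mu> :: "ennreal measure"
  assumes R: "finite_measure R" and [measurable]: "F \<in> borel_measurable R" "X \<in> borel_measurable R"
    and le: "\<And>x. F x \<le> 1" and \<mu>: "sets \<mu> = sets borel" and B: "B \<in> sets borel"
    and eq: "\<And>n::nat. (\<integral>\<^sup>+x. F x * ennreal_exp_neg (of_nat n * X x) \<partial>R)
                = (\<integral>\<^sup>+z. ennreal_exp_neg (of_nat n * z) \<partial>\<mu>)"
  shows "(\<integral>\<^sup>+x. F x * indicator B (X x) \<partial>R) = emeasure \<mu> B"
proof -
  interpret R: finite_measure R by fact
  have [measurable]: "X \<in> density R F \<rightarrow>\<^sub>M borel" by simp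
  have "distr (density R F) borel X = \<mu>"
  proof (rule finite_measure_eq_laplace_nat)
    have "(\<integral>\<^sup>+x. F x \<partial>R) \<le> (\<integral>\<^sup>+x. 1 \<partial>R)"
      using le by (intro nn_integral_mono) auto
    also have "\<dots> < \<top>" by (simp add: less_top[symmetric])
    finally show "finite_measure (distr (density R F) borel X)"
      by (intro finite_measureI) (simp add: emeasure_distr emeasure_density less_top cong: nn_integral_cong)
    fix n :: nat
    show "(\<integral>\<^sup>+x. ennreal_exp_neg (of_nat n * x) \<partial>distr (density R F) borel X)
        = (\<integral>\<^sup>+x. ennreal_exp_neg (of_nat n * x) \<partial>\<mu>)"
      by (simp add: nn_integral_distr nn_integral_density eq)
  qed (simp_all add: \<mu>)
  then have "emeasure \<mu> B = emeasure (distr (density R F) borel X) B" by simp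
  also have "\<dots> = (\<integral>\<^sup>+x. F x * indicator (X -` B \<inter> space R) x \<partial>R)"
    using B by (simp add: emeasure_distr emeasure_density)
  also have "\<dots> = (\<integral>\<^sup>+x. F x * indicator B (X x) \<partial>R)"
    by (intro nn_integral_cong) (auto split: split_indicator)
  finally show ?thesis by simp
qed

text \<open>Makes the weights closed under the exchange: a factor \<open>exp(-n N(A))\<close> is
  absorbed into the test function.\<close>

lemma ennreal_exp_neg_nn_integral_add_indicator:
  assumes "sets N = sets K" "A \<in> sets K" and g: "g \<in> borel_measurable K" "\<And>y. 0 \<le> g y"
  shows "ennreal_exp_neg (\<integral>\<^sup>+y. ennreal (g y + real n * indicator A y) \<partial>N)
    = ennreal_exp_neg (\<integral>\<^sup>+y. ennreal (g y) \<partial>N) * ennreal_exp_neg (of_nat n * emeasure N A)"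
proof -
  have [measurable]: "g \<in> borel_measurable N" "A \<in> sets N"
    using assms by (simp_all cong: measurable_cong_sets)
  have "(\<integral>\<^sup>+y. ennreal (g y + real n * indicator A y) \<partial>N)
      = (\<integral>\<^sup>+y. ennreal (g y) + of_nat n * indicator A y \<partial>N)"
    using g by (intro nn_integral_cong) (auto simp: ennreal_of_nat_eq_real_of_nat split: split_indicator)
  also have "\<dots> = (\<integral>\<^sup>+y. ennreal (g y) \<partial>N) + of_nat n * emeasure N A"
    by (subst nn_integral_add) (auto simp: nn_integral_cmult_indicator)
  finally show ?thesis by (simp add: ennreal_exp_neg_add)
qed

lemma prod_indicator_le_1: "(\<Prod>i\<in>I. indicator (B i) (f i)) \<le> (1::ennreal)"
  by (intro prod_le_1) (auto split: split_indicator)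

lemma mult_le_1_ennreal: "x \<le> 1 \<Longrightarrow> y \<le> 1 \<Longrightarrow> x * y \<le> (1::ennreal)"
  using mult_mono[of x 1 y 1] by simp

lemma meas_algebra_eqI_laplace_functional:
  assumes P: "prob_space P" "sets P = sets (meas_algebra K)"
    and Q: "prob_space Q" "sets Q = sets (meas_algebra K)"
    and eq: "\<And>g. g \<in> borel_measurable K \<Longrightarrow> (\<And>y. 0 \<le> g y) \<Longrightarrow>
               laplace_functional P g = laplace_functional Q g"
  shows "P = Q"
proof -
  interpret P: prob_space P by fact
  interpret Q: prob_space Q by fact
  note [measurable_cong] = P(2) Q(2)
  have sp: "space P = {N. sets N = sets K}" "space Q = {N. sets N = sets K}"
    using sets_eq_imp_space_eq[OF P(2)] sets_eq_imp_space_eq[OF Q(2)] by (simp_all add: space_meas_algebra)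
  let ?W = "\<lambda>I B g N. (\<Prod>A\<in>I. indicator (B A) (emeasure N A)) * ennreal_exp_neg (\<integral>\<^sup>+y. ennreal (g y) \<partial>N)"
  \<comment> \<open>\<open>g\<close> must stay arbitrary in the induction: the step for a new set
    \<open>A\<close> uses the induction hypothesis at \<open>g + n * indicator A\<close> for every
    \<open>n\<close>.\<close>
  have swap: "(\<integral>\<^sup>+N. ?W I B g N \<partial>P) = (\<integral>\<^sup>+N. ?W I B g N \<partial>Q)"
    if "finite I" "I \<subseteq> sets K" "\<And>A. A \<in> I \<Longrightarrow> B A \<in> sets borel"
      "g \<in> borel_measurable K" "\<And>y. 0 \<le> g y" for I g and B :: "'a set \<Rightarrow> ennreal set"
    using that
  proof (induction I arbitrary: g rule: finite_induct)
    case empty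
    then show ?case using eq[of g] by (simp add: laplace_functional_def)
  next
    case (insert A I)
    note [measurable] = insert.prems(3)
    have A[measurable]: "A \<in> sets K" and BA: "B A \<in> sets borel"
      and IB[measurable]: "\<And>A. A \<in> I \<Longrightarrow> A \<in> sets K" "\<And>A. A \<in> I \<Longrightarrow> B A \<in> sets borel"
      using insert.prems by auto
    let ?F = "?W I B g" and ?X = "\<lambda>N. emeasure N A"
    have meas: "?F \<in> borel_measurable (meas_algebra K)" by measurable
    have meas': "?X \<in> borel_measurable (meas_algebra K)" by measurable
    have le: "?F N \<le> 1" for N
      by (intro mult_le_1_ennreal prod_indicator_le_1 ennreal_exp_neg_le_1)
    have add: "?F N * ennreal_exp_neg (of_nat n * ?X N) = ?W I B (\<lambda>y. g y + real n * indicator A y) N"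
      if "sets N = sets K" for N n
      using ennreal_exp_neg_nn_integral_add_indicator[OF that A insert.prems(3,4), of n]
      by (simp add: mult.assoc)
    have m [measurable]: "?F \<in> borel_measurable P" "?X \<in> borel_measurable P" "?F \<in> borel_measurable Q"
      "?X \<in> borel_measurable Q" using meas meas' by simp_all
    have Wi: "?W (insert A I) B g N = ?F N * indicator (B A) (?X N)" for N
      using insert.hyps by (simp add: mult_ac)
    \<comment> \<open>The comparison measure is the law of \<open>N(A)\<close> under
      \<open>Q\<close> with the same weight, so agreement of its transform with the one under
      \<open>P\<close> is exactly the induction hypothesis.\<close>
    have "(\<integral>\<^sup>+N. ?F N * indicator (B A) (?X N) \<partial>P) = emeasure (distr (density Q ?F) borel ?X) (B A)"
    proof (rule nn_integral_weight_indicator_eqI[OF P.finite_measure_axioms m(1,2) le _ BA])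
      fix n
      have mx: "?X \<in> density Q ?F \<rightarrow>\<^sub>M borel" by simp
      have "(\<integral>\<^sup>+N. ?F N * ennreal_exp_neg (of_nat n * ?X N) \<partial>P)
          = (\<integral>\<^sup>+N. ?W I B (\<lambda>y. g y + real n * indicator A y) N \<partial>P)"
        by (intro nn_integral_cong add) (simp add: sp)
      also have "\<dots> = (\<integral>\<^sup>+N. ?W I B (\<lambda>y. g y + real n * indicator A y) N \<partial>Q)"
        using insert.prems by (intro insert.IH) (auto intro!: IB)
      also have "\<dots> = (\<integral>\<^sup>+N. ?F N * ennreal_exp_neg (of_nat n * ?X N) \<partial>Q)"
        by (intro nn_integral_cong add[symmetric]) (simp add: sp)
      also have "\<dots> = (\<integral>\<^sup>+N. ennreal_exp_neg (of_nat n * ?X N) \<partial>density Q ?F)"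
        by (rule nn_integral_density[symmetric]) measurable
      also have "\<dots> = (\<integral>\<^sup>+z. ennreal_exp_neg (of_nat n * z) \<partial>distr (density Q ?F) borel ?X)"
        using mx by (intro nn_integral_distr[symmetric]) measurable
      finally show "(\<integral>\<^sup>+N. ?F N * ennreal_exp_neg (of_nat n * ?X N) \<partial>P)
          = (\<integral>\<^sup>+z. ennreal_exp_neg (of_nat n * z) \<partial>distr (density Q ?F) borel ?X)" .
    qed simp
    also have "\<dots> = (\<integral>\<^sup>+N. ?F N * indicator (?X -` B A \<inter> space Q) N \<partial>Q)"
      using BA m by (subst emeasure_distr) (auto simp: emeasure_density measurable_sets)
    also have "\<dots> = (\<integral>\<^sup>+N. ?F N * indicator (B A) (?X N) \<partial>Q)"
      by (intro nn_integral_cong) (auto split: split_indicator)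
    finally show ?case by (simp only: Wi)
  qed
  let ?\<Omega> = "{N. sets N = sets K}"
  let ?C = "\<lambda>I B. {N \<in> ?\<Omega>. \<forall>A\<in>I. emeasure N A \<in> B A}"
  \<comment> \<open>Cylinders over finitely many evaluations: an intersection-stable generator on
    which \<open>swap\<close> can be read off.\<close>
  define G where "G = {?C I B | I B. finite I \<and> I \<subseteq> sets K \<and> (\<forall>A\<in>I. B A \<in> sets (borel :: ennreal measure))}"
  have G\<Omega>: "G \<subseteq> Pow ?\<Omega>" by (auto simp: G_def)
  have gen: "sets (meas_algebra K) = sigma_sets ?\<Omega> G"
  proof -
    have "C \<in> sets (meas_algebra K)" if "C \<in> G" for C
    proof -
      obtain I B where C: "C = ?C I B" and I: "finite I" "I \<subseteq> sets K" "\<forall>A\<in>I. B A \<in> sets borel"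
        using \<open>C \<in> G\<close> unfolding G_def by blast
      have [measurable]: "A \<in> I \<Longrightarrow> A \<in> sets K" "A \<in> I \<Longrightarrow> B A \<in> sets borel" for A
        using I by auto
      have "{N \<in> space (meas_algebra K). \<forall>A\<in>I. emeasure N A \<in> B A} \<in> sets (meas_algebra K)"
        using I(1) by measurable
      then show ?thesis by (simp add: C space_meas_algebra)
    qed
    then have 1: "sigma_sets ?\<Omega> G \<subseteq> sets (meas_algebra K)"
      using sets.sigma_sets_subset[of G "meas_algebra K"] by (auto simp: space_meas_algebra)
    \<comment> \<open>Measurability of the identity expresses that \<open>meas_algebra K\<close> is
      contained in the sigma-algebra generated by \<open>G\<close>.\<close>
    have "(\<lambda>N. N) \<in> sigma ?\<Omega> G \<rightarrow>\<^sub>M meas_algebra K"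
    proof (rule measurable_meas_algebra)
      fix A assume A: "A \<in> sets K"
      show "(\<lambda>N. emeasure N A) \<in> borel_measurable (sigma ?\<Omega> G)"
      proof (rule measurableI)
        fix B :: "ennreal set" assume "B \<in> sets borel"
        then have "?C {A} (\<lambda>_. B) \<in> G"
          unfolding G_def using A by (intro CollectI exI[of _ "{A}"] exI[of _ "\<lambda>_. B"]) simp
        then have "?C {A} (\<lambda>_. B) \<in> sets (sigma ?\<Omega> G)" by (rule in_measure_of[OF G\<Omega>])
        also have "?C {A} (\<lambda>_. B) = (\<lambda>N. emeasure N A) -` B \<inter> space (sigma ?\<Omega> G)"
          by (auto simp: space_measure_of_conv)
        finally show "(\<lambda>N. emeasure N A) -` B \<inter> space (sigma ?\<Omega> G) \<in> sets (sigma ?\<Omega> G)" .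
      qed simp
    qed (simp add: space_measure_of_conv)
    note mid = this
    have "X \<in> sets (sigma ?\<Omega> G)" if X: "X \<in> sets (meas_algebra K)" for X
    proof -
      have "X \<subseteq> ?\<Omega>" using sets.sets_into_space[OF X] by (simp add: space_meas_algebra)
      then have "(\<lambda>N. N) -` X \<inter> space (sigma ?\<Omega> G) = X" by (auto simp: space_measure_of_conv)
      then show ?thesis using measurable_sets[OF mid X] by simp
    qed
    then have "sets (meas_algebra K) \<subseteq> sigma_sets ?\<Omega> G"
      unfolding sets_measure_of[OF G\<Omega>] by (rule subsetI)
    with 1 show ?thesis by (rule equalityI[OF _ _, rotated])
  qed
  show ?thesis
  proof (rule measure_eqI_generator_eq[OF _ G\<Omega>, where A = "\<lambda>_. ?\<Omega>"])
    show "Int_stable G"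
    proof (rule Int_stableI)
      fix a b assume "a \<in> G" "b \<in> G"
      then obtain I B J D where a: "a = ?C I B" "finite I" "I \<subseteq> sets K" "\<forall>A\<in>I. B A \<in> sets borel"
        and b: "b = ?C J D" "finite J" "J \<subseteq> sets K" "\<forall>A\<in>J. D A \<in> sets borel"
        unfolding G_def by blast
      \<comment> \<open>Padding with \<open>UNIV\<close> turns both cylinders into cylinders over
        the common index set \<open>I \<union> J\<close>.\<close>
      let ?E = "\<lambda>A. (if A \<in> I then B A else UNIV) \<inter> (if A \<in> J then D A else UNIV)"
      have "a \<inter> b = ?C (I \<union> J) ?E" using a(1) b(1) by (auto split: if_splits)
      moreover have "finite (I \<union> J)" "I \<union> J \<subseteq> sets K" "\<forall>A\<in>I \<union> J. ?E A \<in> sets borel"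
        using a b by auto
      ultimately show "a \<inter> b \<in> G"
        unfolding G_def by (intro CollectI exI[of _ "I \<union> J"] exI[of _ ?E] conjI)
    qed
    fix C assume "C \<in> G"
    then obtain I B where C: "C = ?C I B" and I: "finite I" "I \<subseteq> sets K" "\<forall>A\<in>I. B A \<in> sets borel"
      unfolding G_def by blast
    \<comment> \<open>For \<open>g = 0\<close> the exponential factor is 1 and the product of
      indicators is the indicator of the cylinder.\<close>
    have CR: "emeasure R C = (\<integral>\<^sup>+N. ?W I B (\<lambda>_. 0) N \<partial>R)"
      if "sets R = sets (meas_algebra K)" "space R = ?\<Omega>" for R
    proof -
      have "C \<in> sets R" using \<open>C \<in> G\<close> gen that by auto
      then have "emeasure R C = (\<integral>\<^sup>+N. indicator C N \<partial>R)" by simp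
      also have "\<dots> = (\<integral>\<^sup>+N. ?W I B (\<lambda>_. 0) N \<partial>R)"
      proof (rule nn_integral_cong)
        fix N assume "N \<in> space R"
        then show "indicator C N = ?W I B (\<lambda>_. 0) N"
          using I(1) by (auto simp: C that indicator_def prod_zero_iff)
      qed
      finally show ?thesis .
    qed
    show "emeasure P C = emeasure Q C"
      using swap[OF I(1,2), of B "\<lambda>_. 0"] I(3) by (simp only: CR[OF P(2) sp(1)] CR[OF Q(2) sp(2)]) auto
  next
    have "?C {} (\<lambda>_. {}) \<in> G"
      unfolding G_def by (intro CollectI exI[of _ "{}"] exI[of _ "\<lambda>_. {}"]) simp
    then show "range (\<lambda>_. ?\<Omega>) \<subseteq> G" by auto
  qed (auto simp: P Q gen)
qed

section \<open>Poisson random measures through Laplace functionals\<close>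

text \<open>Rate zero has to be covered because null sets occur among the evaluated sets and among
  the cells of the partition.\<close>

definition poisson0_pmf :: "real \<Rightarrow> nat pmf" where
  "poisson0_pmf m = (if m = 0 then return_pmf 0 else poisson_pmf m)"

lemma pmf_poisson0: "0 \<le> m \<Longrightarrow> pmf (poisson0_pmf m) k = m ^ k / fact k * exp (- m)"
  by (auto simp: poisson0_pmf_def indicator_def)

text \<open>The Poisson generating function, from the exponential series. Below, \<open>c\<close> is
  a value or an integral of \<open>exp(-x)\<close>, and \<open>c = 0\<close> corresponds to
  \<open>x = \<infinity>\<close>.\<close>

lemma nn_integral_poisson0_power:
  assumes m: "0 \<le> m" and c: "c \<le> 1"
  shows "(\<integral>\<^sup>+k. c ^ k \<partial>measure_pmf (poisson0_pmf m)) = ennreal_exp_neg (ennreal m * (1 - c))"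
proof -
  obtain r where r: "c = ennreal r" "0 \<le> r" "r \<le> 1"
    using c by (cases c) (auto simp: top_unique)
  have "(\<integral>\<^sup>+k. c ^ k \<partial>measure_pmf (poisson0_pmf m))
      = (\<Sum>k. ennreal ((m * r) ^ k / fact k * exp (- m)))"
    using m r unfolding nn_integral_measure_pmf nn_integral_count_space_nat
    by (intro suminf_cong) (simp add: pmf_poisson0 ennreal_power power_mult_distrib mult_ac flip: ennreal_mult)
  also have "\<dots> = ennreal (exp (m * r) * exp (- m))"
  proof (rule suminf_ennreal_eq)
    show "(\<lambda>k. (m * r) ^ k / fact k * exp (- m)) sums (exp (m * r) * exp (- m))"
      using exp_converges[of "m * r"] by (intro sums_mult2) (simp add: divide_inverse mult.commute)
  qed (use m r in auto)
  also have "\<dots> = ennreal_exp_neg (ennreal (m * (1 - r)))"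
    using m r by (subst ennreal_exp_neg_ennreal) (auto simp: algebra_simps mult_left_le simp flip: exp_add)
  also have "ennreal (m * (1 - r)) = ennreal m * (1 - c)"
    using m r by (simp add: ennreal_mult ennreal_minus[symmetric] flip: ennreal_1)
  finally show ?thesis .
qed

text \<open>\<open>1 - exp(-g)\<close> is not additive in \<open>g\<close> in general, but it is for
  functions with disjoint supports, since at each point at most one of them is nonzero. This is the
  source of independence over disjoint sets.\<close>

lemma nn_integral_one_minus_exp_neg_add_indicator:
  assumes A: "A \<in> sets \<nu>" and g: "g \<in> borel_measurable \<nu>" "\<And>y. 0 \<le> g y" "\<And>y. y \<in> A \<Longrightarrow> g y = 0"
  shows "(\<integral>\<^sup>+y. 1 - ennreal_exp_neg (ennreal (g y + real n * indicator A y)) \<partial>\<nu>)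
    = (\<integral>\<^sup>+y. 1 - ennreal_exp_neg (ennreal (g y)) \<partial>\<nu>)
      + (\<integral>\<^sup>+y. 1 - ennreal_exp_neg (ennreal (real n * indicator A y)) \<partial>\<nu>)"
proof -
  note [measurable] = A g(1)
  have "(\<integral>\<^sup>+y. 1 - ennreal_exp_neg (ennreal (g y + real n * indicator A y)) \<partial>\<nu>)
    = (\<integral>\<^sup>+y. (1 - ennreal_exp_neg (ennreal (g y)))
          + (1 - ennreal_exp_neg (ennreal (real n * indicator A y))) \<partial>\<nu>)"
    by (intro nn_integral_cong) (auto simp: g(3) split: split_indicator)
  also have "\<dots> = (\<integral>\<^sup>+y. 1 - ennreal_exp_neg (ennreal (g y)) \<partial>\<nu>)
      + (\<integral>\<^sup>+y. 1 - ennreal_exp_neg (ennreal (real n * indicator A y)) \<partial>\<nu>)"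
    by (rule nn_integral_add) measurable
  finally show ?thesis .
qed

text \<open>The working form of the Poisson property: existence is checked against it and uniqueness
  is immediate in it. The lemmas \<open>is_prm_law\<close> and
  \<open>is_prm_law_imp_laplace_prm\<close> translate to and from the definition by counts and
  independence.\<close>

locale laplace_prm = P: prob_space P for \<nu> :: "'a measure" and P :: "'a measure measure" +
  assumes sets_P [measurable_cong]: "sets P = sets (meas_algebra \<nu>)"
    and laplace: "\<And>g. g \<in> borel_measurable \<nu> \<Longrightarrow> (\<And>y. 0 \<le> g y) \<Longrightarrow>
      laplace_functional P g = ennreal_exp_neg (\<integral>\<^sup>+y. 1 - ennreal_exp_neg (ennreal (g y)) \<partial>\<nu>)"
begin

lemma space_P: "space P = {N. sets N = sets \<nu>}"
  using sets_eq_imp_space_eq[OF sets_P] by (simp add: space_meas_algebra)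

lemma laplace_evaluation:
  assumes A: "A \<in> sets \<nu>"
  shows "(\<integral>\<^sup>+N. ennreal_exp_neg (of_nat n * emeasure N A) \<partial>P)
    = ennreal_exp_neg (\<integral>\<^sup>+y. 1 - ennreal_exp_neg (ennreal (real n * indicator A y)) \<partial>\<nu>)"
proof -
  have "(\<integral>\<^sup>+N. ennreal_exp_neg (of_nat n * emeasure N A) \<partial>P)
      = laplace_functional P (\<lambda>y. real n * indicator A y)"
    unfolding laplace_functional_def
  proof (rule nn_integral_cong)
    fix N assume "N \<in> space P"
    then have "sets N = sets \<nu>" by (simp add: space_P)
    from ennreal_exp_neg_nn_integral_add_indicator[OF this A, of "\<lambda>_. 0" n]
    show "ennreal_exp_neg (of_nat n * emeasure N A)
        = ennreal_exp_neg (\<integral>\<^sup>+y. ennreal (real n * indicator A y) \<partial>N)"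
      by simp
  qed
  also have "\<dots> = ennreal_exp_neg (\<integral>\<^sup>+y. 1 - ennreal_exp_neg (ennreal (real n * indicator A y)) \<partial>\<nu>)"
    using A by (intro laplace) auto
  finally show ?thesis .
qed

lemma one_minus_exp_neg_indicator:
  "A \<in> sets \<nu> \<Longrightarrow> (\<integral>\<^sup>+y. 1 - ennreal_exp_neg (ennreal (real n * indicator A y)) \<partial>\<nu>)
    = (1 - ennreal_exp_neg (of_nat n)) * emeasure \<nu> A"
  by (subst nn_integral_cmult_indicator[symmetric])
    (auto intro!: nn_integral_cong split: split_indicator simp: ennreal_of_nat_eq_real_of_nat)

text \<open>Both laws have transform \<open>exp(-\<nu>(A) (1 - exp(-n)))\<close> at
  \<open>n\<close>: the left one by the Laplace functional at \<open>n 1_A\<close>, the right one by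
  the Poisson generating function at \<open>exp(-n)\<close>.\<close>

lemma distr_evaluation:
  assumes A: "A \<in> sets \<nu>" "emeasure \<nu> A < \<infinity>"
  shows "distr P borel (\<lambda>N. emeasure N A) = distr (measure_pmf (poisson0_pmf (measure \<nu> A))) borel of_nat"
proof (rule prob_eq_laplace_nat)
  note [measurable] = A(1)
  show "prob_space (distr P borel (\<lambda>N. emeasure N A))"
    by (rule P.prob_space_distr) measurable
  show "prob_space (distr (measure_pmf (poisson0_pmf (measure \<nu> A))) borel (of_nat :: nat \<Rightarrow> ennreal))"
    by (rule measure_pmf.prob_space_distr) simp
  fix n :: nat
  have "(\<integral>\<^sup>+x. ennreal_exp_neg (of_nat n * x) \<partial>distr (measure_pmf (poisson0_pmf (measure \<nu> A))) borel of_nat)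
      = (\<integral>\<^sup>+k. ennreal_exp_neg (of_nat n) ^ k \<partial>measure_pmf (poisson0_pmf (measure \<nu> A)))"
    using ennreal_exp_neg_of_nat_mult[of _ "of_nat n"]
    by (subst nn_integral_distr) (auto intro!: nn_integral_cong simp: mult.commute)
  also have "\<dots> = ennreal_exp_neg (ennreal (measure \<nu> A) * (1 - ennreal_exp_neg (of_nat n)))"
    by (intro nn_integral_poisson0_power) (auto simp: ennreal_exp_neg_le_1)
  also have "ennreal (measure \<nu> A) = emeasure \<nu> A"
    using A(2) by (simp add: emeasure_eq_ennreal_measure)
  also have "ennreal_exp_neg (emeasure \<nu> A * (1 - ennreal_exp_neg (of_nat n)))
      = (\<integral>\<^sup>+N. ennreal_exp_neg (of_nat n * emeasure N A) \<partial>P)"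
    using A by (simp add: laplace_evaluation one_minus_exp_neg_indicator mult.commute)
  also have "\<dots> = (\<integral>\<^sup>+x. ennreal_exp_neg (of_nat n * x) \<partial>distr P borel (\<lambda>N. emeasure N A))"
    by (rule nn_integral_distr[symmetric]) measurable
  finally show "(\<integral>\<^sup>+x. ennreal_exp_neg (of_nat n * x) \<partial>distr P borel (\<lambda>N. emeasure N A))
    = (\<integral>\<^sup>+x. ennreal_exp_neg (of_nat n * x) \<partial>distr (measure_pmf (poisson0_pmf (measure \<nu> A))) borel of_nat)"
    by simp
qed simp_all

text \<open>The transform at 1 is \<open>exp(-\<infinity>) = 0\<close>, and a nonnegative function
  with zero integral vanishes almost everywhere.\<close>

lemma AE_evaluation_infinite:
  assumes A: "A \<in> sets \<nu>" "emeasure \<nu> A = \<infinity>"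
  shows "AE N in P. emeasure N A = \<infinity>"
proof -
  note [measurable] = A(1)
  have "1 - ennreal_exp_neg 1 \<noteq> 0"
    using ennreal_exp_neg_eq_1_iff[of 1] ennreal_exp_neg_le_1[of 1]
    by (metis antisym ennreal_minus_eq_0 zero_neq_one)
  then have "(\<integral>\<^sup>+N. ennreal_exp_neg (emeasure N A) \<partial>P) = 0"
    using laplace_evaluation[OF A(1), of 1] one_minus_exp_neg_indicator[OF A(1), of 1] A(2)
    by (simp add: ennreal_mult_top)
  then have "AE N in P. ennreal_exp_neg (emeasure N A) = 0"
    by (subst (asm) nn_integral_0_iff_AE) auto
  then show ?thesis by (simp add: ennreal_exp_neg_eq_0_iff)
qed

text \<open>Independence, strengthened by a factor \<open>exp(-N(g))\<close> with \<open>g\<close>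
  vanishing on all the sets so that the induction goes through: the step for \<open>A j\<close> uses
  \<open>g + n * indicator (A j)\<close>, which still vanishes on the remaining sets because they
  are disjoint from \<open>A j\<close>.\<close>

lemma prod_evaluation:
  assumes "finite I" "disjoint_family_on A I" "\<And>i. i \<in> I \<Longrightarrow> A i \<in> sets \<nu>"
    "\<And>i. i \<in> I \<Longrightarrow> B i \<in> sets borel" "g \<in> borel_measurable \<nu>" "\<And>y. 0 \<le> g y"
    "\<And>i y. i \<in> I \<Longrightarrow> y \<in> A i \<Longrightarrow> g y = 0"
  shows "(\<integral>\<^sup>+N. (\<Prod>i\<in>I. indicator (B i) (emeasure N (A i))) * ennreal_exp_neg (\<integral>\<^sup>+y. ennreal (g y) \<partial>N) \<partial>P)
    = (\<Prod>i\<in>I. emeasure P {N\<in>space P. emeasure N (A i) \<in> B i}) * laplace_functional P g"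
  using assms
proof (induction I arbitrary: g rule: finite_induct)
  case empty
  then show ?case by (simp add: laplace_functional_def)
next
  case (insert j I)
  note g [measurable] = insert.prems(4)
  have Aj[measurable]: "A j \<in> sets \<nu>" and Bj[measurable]: "B j \<in> sets borel"
    and IB[measurable]: "\<And>i. i \<in> I \<Longrightarrow> A i \<in> sets \<nu>" "\<And>i. i \<in> I \<Longrightarrow> B i \<in> sets borel"
    using insert.prems by auto
  have disj: "disjoint_family_on A I"
    using insert.prems(1) by (rule disjoint_family_on_mono[rotated]) auto
  let ?F = "\<lambda>g N. (\<Prod>i\<in>I. indicator (B i) (emeasure N (A i))) * ennreal_exp_neg (\<integral>\<^sup>+y. ennreal (g y) \<partial>N)"
  let ?c = "\<Prod>i\<in>I. emeasure P {N\<in>space P. emeasure N (A i) \<in> B i}"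
  let ?d = "?c * laplace_functional P g"
  \<comment> \<open>Comparing with a constant multiple of the unweighted law of
    \<open>N(A j)\<close> is what makes the new factor split off; the multiple \<open>?d\<close> is
    the value obtained without the set \<open>A j\<close>.\<close>
  have "(\<integral>\<^sup>+N. ?F g N * indicator (B j) (emeasure N (A j)) \<partial>P)
      = emeasure (scale_measure ?d (distr P borel (\<lambda>N. emeasure N (A j)))) (B j)"
  proof (rule nn_integral_weight_indicator_eqI[OF P.finite_measure_axioms _ _ _ _ Bj])
    show "?F g N \<le> 1" for N
      by (intro mult_le_1_ennreal prod_indicator_le_1 ennreal_exp_neg_le_1)
    fix n
    let ?g = "\<lambda>y. g y + real n * indicator (A j) y"
    have "(\<integral>\<^sup>+N. ?F g N * ennreal_exp_neg (of_nat n * emeasure N (A j)) \<partial>P) = (\<integral>\<^sup>+N. ?F ?g N \<partial>P)"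
    proof (rule nn_integral_cong)
      fix N assume "N \<in> space P"
      then have "sets N = sets \<nu>" by (simp add: space_P)
      from ennreal_exp_neg_nn_integral_add_indicator[OF this Aj g, of n] insert.prems(5)
      show "?F g N * ennreal_exp_neg (of_nat n * emeasure N (A j)) = ?F ?g N"
        by (simp add: mult.assoc)
    qed
    also have "\<dots> = ?c * laplace_functional P ?g"
    proof (rule insert.IH[OF disj])
      fix i y assume "i \<in> I" "y \<in> A i"
      then show "?g y = 0"
        using insert.prems(1,6) insert.hyps by (auto simp: disjoint_family_on_def indicator_def)
    qed (use insert.prems in auto)
    also have "laplace_functional P ?g = laplace_functional P g
        * ennreal_exp_neg (\<integral>\<^sup>+y. 1 - ennreal_exp_neg (ennreal (real n * indicator (A j) y)) \<partial>\<nu>)"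
    proof -
      have "laplace_functional P ?g = ennreal_exp_neg (\<integral>\<^sup>+y. 1 - ennreal_exp_neg (ennreal (?g y)) \<partial>\<nu>)"
        using insert.prems(5) by (intro laplace) auto
      also have "\<dots> = ennreal_exp_neg ((\<integral>\<^sup>+y. 1 - ennreal_exp_neg (ennreal (g y)) \<partial>\<nu>)
          + (\<integral>\<^sup>+y. 1 - ennreal_exp_neg (ennreal (real n * indicator (A j) y)) \<partial>\<nu>))"
        using insert.prems(5,6)
        by (subst nn_integral_one_minus_exp_neg_add_indicator[OF Aj g]) auto
      finally show ?thesis
        using insert.prems(5) by (simp only: ennreal_exp_neg_add laplace[OF g])
    qed
    also have "\<dots> = laplace_functional P g * (\<integral>\<^sup>+N. ennreal_exp_neg (of_nat n * emeasure N (A j)) \<partial>P)"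
      by (simp only: laplace_evaluation[OF Aj])
    also have "(\<integral>\<^sup>+N. ennreal_exp_neg (of_nat n * emeasure N (A j)) \<partial>P)
        = (\<integral>\<^sup>+z. ennreal_exp_neg (of_nat n * z) \<partial>distr P borel (\<lambda>N. emeasure N (A j)))"
      by (rule nn_integral_distr[symmetric]) measurable
    finally show "(\<integral>\<^sup>+N. ?F g N * ennreal_exp_neg (of_nat n * emeasure N (A j)) \<partial>P)
        = (\<integral>\<^sup>+z. ennreal_exp_neg (of_nat n * z) \<partial>scale_measure ?d (distr P borel (\<lambda>N. emeasure N (A j))))"
      by (subst nn_integral_scale_measure) (simp_all add: mult.assoc)
    have "?F g \<in> borel_measurable (meas_algebra \<nu>)" by measurable
    then show "?F g \<in> borel_measurable P" by (simp add: measurable_cong_sets[OF sets_P refl])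
  qed simp_all
  also have "\<dots> = ?d * emeasure P {N\<in>space P. emeasure N (A j) \<in> B j}"
    by (simp add: emeasure_distr vimage_def Int_def conj_commute)
  finally show ?case
    using insert.hyps by (simp add: mult_ac)
qed

lemma is_prm_law: "is_prm_law \<nu> P"
  unfolding is_prm_law_def
proof (intro conjI ballI impI allI)
  show "prob_space P" by (rule P.prob_space_axioms)
  show "sets P = sets (meas_algebra \<nu>)" by (rule sets_P)
  show "AE N in P. emeasure N A = \<infinity>" if "A \<in> sets \<nu>" "emeasure \<nu> A = \<infinity>" for A
    using that by (rule AE_evaluation_infinite)
next
  fix A k assume A: "A \<in> sets \<nu>" "emeasure \<nu> A < \<infinity>"
  note [measurable] = A(1)
  have "emeasure P {N \<in> space P. emeasure N A = of_nat k} = emeasure (distr P borel (\<lambda>N. emeasure N A)) {of_nat k}"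
    by (subst emeasure_distr) (auto intro!: arg_cong[where f="emeasure P"])
  also have "\<dots> = emeasure (measure_pmf (poisson0_pmf (measure \<nu> A))) {k}"
    unfolding distr_evaluation[OF A]
    by (subst emeasure_distr) (auto intro!: arg_cong2[where f=emeasure])
  also have "\<dots> = ennreal (measure \<nu> A ^ k / fact k * exp (- measure \<nu> A))"
    by (simp add: emeasure_pmf_single pmf_poisson0)
  finally show "emeasure P {N \<in> space P. emeasure N A = of_nat k}
      = ennreal (measure \<nu> A ^ k / fact k * exp (- measure \<nu> A))" .
next
  fix n :: nat and A :: "nat \<Rightarrow> 'a set"
  assume A: "disjoint_family_on A {..<n} \<and> (\<forall>i<n. A i \<in> sets \<nu>)"
  then have A'[measurable]: "\<And>i. i < n \<Longrightarrow> A i \<in> sets \<nu>" by auto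
  show "P.indep_vars (\<lambda>_. borel) (\<lambda>i N. emeasure N (A i)) {..<n}"
    unfolding P.indep_vars_def2
  proof (intro conjI ballI P.indep_setsI)
    show "(\<lambda>N. emeasure N (A i)) \<in> borel_measurable P" if "i \<in> {..<n}" for i
      using A'[of i] that by simp
    then show "{(\<lambda>N. emeasure N (A i)) -` B \<inter> space P |B. B \<in> sets borel} \<subseteq> P.events" if "i \<in> {..<n}" for i
      using that by (auto intro: measurable_sets)
  next
    fix C J
    assume J: "J \<noteq> {}" "J \<subseteq> {..<n}" "finite J"
      and "\<forall>j\<in>J. C j \<in> {(\<lambda>N. emeasure N (A j)) -` B \<inter> space P |B. B \<in> sets borel}"
    then have "\<forall>j\<in>J. \<exists>B. B \<in> sets borel \<and> C j = {N\<in>space P. emeasure N (A j) \<in> B}"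
      by (fastforce simp: vimage_def)
    then obtain B where B: "\<And>j. j \<in> J \<Longrightarrow> B j \<in> sets borel"
      "\<And>j. j \<in> J \<Longrightarrow> C j = {N\<in>space P. emeasure N (A j) \<in> B j}"
      by metis
    note [measurable] = B(1)
    have AJ[measurable]: "A j \<in> sets \<nu>" if "j \<in> J" for j using J that by (intro A') auto
    have C[measurable]: "C j \<in> sets P" if "j \<in> J" for j
      using that by (simp add: B(2))
    \<comment> \<open>The exponential factor written here is 1; it only brings the integral into the
      form of \<open>prod_evaluation\<close> with \<open>g = 0\<close>.\<close>
    have "emeasure P (\<Inter>j\<in>J. C j) = (\<integral>\<^sup>+N. (\<Prod>j\<in>J. indicator (B j) (emeasure N (A j)))
        * ennreal_exp_neg (\<integral>\<^sup>+y. ennreal 0 \<partial>N) \<partial>P)"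
    proof -
      have "(\<Inter>j\<in>J. C j) \<in> sets P" using J by (intro sets.finite_INT) auto
      then have "emeasure P (\<Inter>j\<in>J. C j) = (\<integral>\<^sup>+N. indicator (\<Inter>j\<in>J. C j) N \<partial>P)" by simp
      also have "\<dots> = (\<integral>\<^sup>+N. (\<Prod>j\<in>J. indicator (B j) (emeasure N (A j)))
        * ennreal_exp_neg (\<integral>\<^sup>+y. ennreal 0 \<partial>N) \<partial>P)"
        using J by (intro nn_integral_cong) (auto simp: B(2) indicator_def prod_zero_iff)
      finally show ?thesis .
    qed
    also have "\<dots> = (\<Prod>j\<in>J. emeasure P {N\<in>space P. emeasure N (A j) \<in> B j}) * laplace_functional P (\<lambda>_. 0)"
      using J A B(1) by (intro prod_evaluation) (auto intro: disjoint_family_on_mono)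
    also have "\<dots> = (\<Prod>j\<in>J. emeasure P (C j))"
      by (simp add: B(2) laplace_functional_def P.emeasure_space_1)
    finally show "P.prob (\<Inter>j\<in>J. C j) = (\<Prod>j\<in>J. P.prob (C j))"
      by (simp add: P.emeasure_eq_measure prod_ennreal prod_nonneg)
  qed
qed

end

section \<open>Converse: a Poisson law has the expected Laplace functional\<close>

text \<open>For finite intensity \<open>N(A)\<close> is almost surely a natural number and the claim
  is the Poisson generating function at \<open>exp(-c)\<close>; for infinite intensity
  \<open>N(A) = \<infinity>\<close> almost surely. The factor \<open>c\<close> may itself be
  infinite.\<close>

lemma is_prm_law_nn_integral_exp_neg_emeasure:
  assumes prm: "is_prm_law \<nu> P" and A: "A \<in> sets \<nu>"
  shows "(\<integral>\<^sup>+N. ennreal_exp_neg (c * emeasure N A) \<partial>P) = ennreal_exp_neg ((1 - ennreal_exp_neg c) * emeasure \<nu> A)"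
proof -
  interpret P: prob_space P using prm by (simp add: is_prm_law_def)
  have sets_P[measurable_cong]: "sets P = sets (meas_algebra \<nu>)"
    using prm by (simp add: is_prm_law_def)
  note [measurable] = A
  show ?thesis
  proof (cases "emeasure \<nu> A = \<infinity>")
    case True
    then have ae: "AE N in P. emeasure N A = \<infinity>"
      using prm A by (simp add: is_prm_law_def)
    show ?thesis
    \<comment> \<open>At \<open>c = 0\<close> the convention \<open>0 * \<infinity> = 0\<close>
      makes both sides equal to 1.\<close>
    proof (cases "c = 0")
      case False
      then have "1 - ennreal_exp_neg c \<noteq> 0"
        using ennreal_exp_neg_eq_1_iff[of c] ennreal_exp_neg_le_1[of c]
        by (metis antisym ennreal_minus_eq_0)
      moreover have "(\<integral>\<^sup>+N. ennreal_exp_neg (c * emeasure N A) \<partial>P) = (\<integral>\<^sup>+N. 0 \<partial>P)"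
        using ae False by (intro nn_integral_cong_AE) (auto simp: ennreal_mult_top elim!: eventually_mono)
      ultimately show ?thesis using True by (simp add: ennreal_mult_top)
    qed (simp add: P.emeasure_space_1)
  next
    case False
    define m where "m = measure \<nu> A"
    have m: "emeasure \<nu> A = ennreal m" "0 \<le> m"
      using False by (auto simp: m_def emeasure_eq_ennreal_measure)
    let ?E = "\<lambda>k::nat. {N \<in> space P. emeasure N A = of_nat k}"
    have E: "?E k \<in> sets P" for k by measurable
    have disj: "disjoint_family ?E" by (auto simp: disjoint_family_on_def)
    have eP: "emeasure P (?E k) = pmf (poisson0_pmf m) k" for k
      using prm A False m by (auto simp: is_prm_law_def m_def pmf_poisson0 less_top)
    \<comment> \<open>The definition prescribes only the probabilities of integer values. They add
      up to 1, so \<open>N(A)\<close> takes no other value with positive probability.\<close>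
    have "emeasure P (\<Union>k. ?E k) = (\<Sum>k. emeasure P (?E k))"
      using E disj by (intro suminf_emeasure[symmetric]) auto
    also have "\<dots> = (\<integral>\<^sup>+k. 1 ^ k \<partial>measure_pmf (poisson0_pmf m))"
      unfolding eP nn_integral_measure_pmf nn_integral_count_space_nat by simp
    also have "\<dots> = 1" by simp
    finally have "P.prob (\<Union>k. ?E k) = 1" by (simp add: P.emeasure_eq_measure)
    then have ae: "AE N in P. N \<in> (\<Union>k. ?E k)"
      using E by (subst P.AE_in_set_eq_1) auto
    have "(\<integral>\<^sup>+N. ennreal_exp_neg (c * emeasure N A) \<partial>P)
        = (\<integral>\<^sup>+N. (\<Sum>k. ennreal_exp_neg c ^ k * indicator (?E k) N) \<partial>P)"
    proof (rule nn_integral_cong_AE)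
      show "AE N in P. ennreal_exp_neg (c * emeasure N A)
          = (\<Sum>k. ennreal_exp_neg c ^ k * indicator (?E k) N)"
        using ae
      proof eventually_elim
        case (elim N)
        then obtain k where k: "N \<in> ?E k" by auto
        then have "(\<Sum>k. ennreal_exp_neg c ^ k * indicator (?E k) N) = ennreal_exp_neg c ^ k"
          by (rule suminf_cmult_indicator[OF disj])
        with k show ?case by (simp add: ennreal_exp_neg_of_nat_mult[symmetric] mult.commute)
      qed
    qed
    also have "\<dots> = (\<Sum>k. ennreal_exp_neg c ^ k * emeasure P (?E k))"
      using E by (subst nn_integral_suminf) (auto simp: nn_integral_cmult_indicator)
    also have "\<dots> = (\<integral>\<^sup>+k. ennreal_exp_neg c ^ k \<partial>measure_pmf (poisson0_pmf m))"
      unfolding eP nn_integral_measure_pmf nn_integral_count_space_nat by (simp add: mult.commute)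
    also have "\<dots> = ennreal_exp_neg (ennreal m * (1 - ennreal_exp_neg c))"
      using m by (intro nn_integral_poisson0_power) (auto simp: ennreal_exp_neg_le_1)
    finally show ?thesis using m by (simp add: mult.commute)
  qed
qed

text \<open>The function \<open>\<phi>\<close> is kept general because the same level sets serve
  twice: for \<open>s\<close> under the random measure and for \<open>1 - exp(-s)\<close> under the
  intensity.\<close>

lemma nn_integral_comp_simple_function:
  assumes s: "simple_function \<nu> s" and N: "sets N = sets \<nu>"
  shows "(\<integral>\<^sup>+y. \<phi> (s y) \<partial>N) = (\<Sum>v\<in>s ` space \<nu>. \<phi> v * emeasure N (s -` {v} \<inter> space \<nu>))"
proof -
  have sp: "space N = space \<nu>" using N by (rule sets_eq_imp_space_eq)
  have fin: "finite (s ` space \<nu>)" and meas: "s -` {v} \<inter> space \<nu> \<in> sets N" for v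
    using simple_functionD[OF s] by (auto simp: N)
  have "(\<integral>\<^sup>+y. \<phi> (s y) \<partial>N)
      = (\<integral>\<^sup>+y. (\<Sum>v\<in>s ` space \<nu>. \<phi> v * indicator (s -` {v} \<inter> space \<nu>) y) \<partial>N)"
  proof (rule nn_integral_cong)
    fix y assume y: "y \<in> space N"
    have "(\<Sum>v\<in>s ` space \<nu>. \<phi> v * indicator (s -` {v} \<inter> space \<nu>) y)
        = (\<Sum>v\<in>s ` space \<nu>. if v = s y then \<phi> v else 0)"
      using y sp by (intro sum.cong) (auto simp: indicator_def)
    also have "\<dots> = \<phi> (s y)"
      using y sp fin by (simp add: sum.delta)
    finally show "\<phi> (s y) = (\<Sum>v\<in>s ` space \<nu>. \<phi> v * indicator (s -` {v} \<inter> space \<nu>) y)" by simp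
  qed
  also have "\<dots> = (\<Sum>v\<in>s ` space \<nu>. \<phi> v * emeasure N (s -` {v} \<inter> space \<nu>))"
    using meas by (subst nn_integral_sum) (auto simp: nn_integral_cmult_indicator)
  finally show ?thesis .
qed

lemma is_prm_law_laplace_simple:
  assumes prm: "is_prm_law \<nu> P" and s: "simple_function \<nu> s"
  shows "(\<integral>\<^sup>+N. ennreal_exp_neg (\<integral>\<^sup>+y. s y \<partial>N) \<partial>P) = ennreal_exp_neg (\<integral>\<^sup>+y. 1 - ennreal_exp_neg (s y) \<partial>\<nu>)"
proof -
  interpret P: prob_space P using prm by (simp add: is_prm_law_def)
  have sets_P[measurable_cong]: "sets P = sets (meas_algebra \<nu>)"
    using prm by (simp add: is_prm_law_def)
  have space_P: "space P = {N. sets N = sets \<nu>}"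
    using sets_eq_imp_space_eq[OF sets_P] by (simp add: space_meas_algebra)
  \<comment> \<open>Independence is given for families indexed by \<open>{..<n}\<close>, so the
    values of \<open>s\<close> are enumerated. The level sets are disjoint, and the expectation of
    the product of exponentials factorises.\<close>
  obtain h where h: "bij_betw h {0..<card (s ` space \<nu>)} (s ` space \<nu>)"
    using ex_bij_betw_nat_finite simple_functionD(1)[OF s] by blast
  define n where "n = card (s ` space \<nu>)"
  have h: "bij_betw h {..<n} (s ` space \<nu>)" using h by (simp add: n_def atLeast0LessThan)
  define A where "A i = s -` {h i} \<inter> space \<nu>" for i
  have A[measurable]: "A i \<in> sets \<nu>" for i
    using simple_functionD(2)[OF s] by (simp add: A_def)
  have disj: "disjoint_family_on A {..<n}"
    using h by (auto simp: disjoint_family_on_def A_def bij_betw_def inj_on_def)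
  have eq: "(\<integral>\<^sup>+y. \<phi> (s y) \<partial>N) = (\<Sum>i<n. \<phi> (h i) * emeasure N (A i))" if "sets N = sets \<nu>" for N \<phi>
    unfolding nn_integral_comp_simple_function[OF s that] A_def
    by (rule sum.reindex_bij_betw[OF h, symmetric])
  have indep: "P.indep_vars (\<lambda>_. borel) (\<lambda>i N. emeasure N (A i)) {..<n}"
    using prm disj A by (simp add: is_prm_law_def)
  have "(\<integral>\<^sup>+N. ennreal_exp_neg (\<integral>\<^sup>+y. s y \<partial>N) \<partial>P)
      = (\<integral>\<^sup>+N. (\<Prod>i<n. ennreal_exp_neg (h i * emeasure N (A i))) \<partial>P)"
    using eq[of _ "\<lambda>x. x"]
    by (intro nn_integral_cong) (simp add: space_P ennreal_exp_neg_sum)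
  also have "\<dots> = (\<Prod>i<n. \<integral>\<^sup>+N. ennreal_exp_neg (h i * emeasure N (A i)) \<partial>P)"
    by (intro P.indep_vars_nn_integral P.indep_vars_compose2[OF indep]) auto
  also have "\<dots> = ennreal_exp_neg (\<Sum>i<n. (1 - ennreal_exp_neg (h i)) * emeasure \<nu> (A i))"
    by (simp add: is_prm_law_nn_integral_exp_neg_emeasure[OF prm] ennreal_exp_neg_sum)
  also have "(\<Sum>i<n. (1 - ennreal_exp_neg (h i)) * emeasure \<nu> (A i)) = (\<integral>\<^sup>+y. 1 - ennreal_exp_neg (s y) \<partial>\<nu>)"
    by (rule eq[symmetric]) simp
  finally show ?thesis .
qed

text \<open>Approximate \<open>g\<close> from below by simple functions. The inner integrals
  converge monotonically, on the side of \<open>N\<close> as on the side of \<open>\<nu>\<close>,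
  and the expectation converges by domination by the constant 1.\<close>

lemma is_prm_law_imp_laplace_prm:
  assumes prm: "is_prm_law \<nu> P"
  shows "laplace_prm \<nu> P"
proof -
  interpret P: prob_space P using prm by (simp add: is_prm_law_def)
  have sets_P[measurable_cong]: "sets P = sets (meas_algebra \<nu>)"
    using prm by (simp add: is_prm_law_def)
  have space_P: "space P = {N. sets N = sets \<nu>}"
    using sets_eq_imp_space_eq[OF sets_P] by (simp add: space_meas_algebra)
  show ?thesis
  proof
    show "sets P = sets (meas_algebra \<nu>)" by (rule sets_P)
    fix g :: "'a \<Rightarrow> real" assume g: "g \<in> borel_measurable \<nu>" "\<And>y. 0 \<le> g y"
    then have "(\<lambda>y. ennreal (g y)) \<in> borel_measurable \<nu>" by simp
    from borel_measurable_implies_simple_function_sequence'[OF this]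
    obtain f where f: "\<And>i. simple_function \<nu> (f i)" "incseq f" "\<And>i x. f i x < top"
      "\<And>x. (SUP i. f i x) = ennreal (g x)" by blast
    have fm[measurable]: "f i \<in> borel_measurable \<nu>" for i
      using f(1) by (rule borel_measurable_simple_function)
    have lim: "(\<lambda>i. f i y) \<longlonglongrightarrow> ennreal (g y)" for y
      unfolding f(4)[symmetric] using f(2) by (intro LIMSEQ_SUP) (auto simp: incseq_def le_fun_def)
    have "(\<lambda>i. \<integral>\<^sup>+N. ennreal_exp_neg (\<integral>\<^sup>+y. f i y \<partial>N) \<partial>P) \<longlonglongrightarrow> laplace_functional P g"
      unfolding laplace_functional_def
    proof (rule nn_integral_dominated_convergence[where w = "\<lambda>_. 1"])
      show "AE N in P. (\<lambda>i. ennreal_exp_neg (\<integral>\<^sup>+y. f i y \<partial>N)) \<longlonglongrightarrow> ennreal_exp_neg (\<integral>\<^sup>+y. ennreal (g y) \<partial>N)"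
      proof (rule AE_I2)
        fix N assume "N \<in> space P"
        then have N: "sets N = sets \<nu>" by (simp add: space_P)
        then have "f i \<in> borel_measurable N" for i
          using fm[of i] by (simp add: measurable_cong_sets[OF N refl])
        then show "(\<lambda>i. ennreal_exp_neg (\<integral>\<^sup>+y. f i y \<partial>N)) \<longlonglongrightarrow> ennreal_exp_neg (\<integral>\<^sup>+y. ennreal (g y) \<partial>N)"
          by (intro tendsto_ennreal_exp_neg nn_integral_LIMSEQ f(2) lim)
      qed
    qed (use g in \<open>auto simp: ennreal_exp_neg_le_1 P.emeasure_space_1\<close>)
    moreover have "(\<lambda>i. ennreal_exp_neg (\<integral>\<^sup>+y. 1 - ennreal_exp_neg (f i y) \<partial>\<nu>))
        \<longlonglongrightarrow> ennreal_exp_neg (\<integral>\<^sup>+y. 1 - ennreal_exp_neg (ennreal (g y)) \<partial>\<nu>)"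
    proof (intro tendsto_ennreal_exp_neg nn_integral_LIMSEQ)
      show "incseq (\<lambda>i y. 1 - ennreal_exp_neg (f i y))"
        using f(2) by (auto simp: incseq_def le_fun_def intro!: ennreal_minus_mono ennreal_exp_neg_antimono)
      show "(\<lambda>i. 1 - ennreal_exp_neg (f i y)) \<longlonglongrightarrow> 1 - ennreal_exp_neg (ennreal (g y))" for y
        by (intro tendsto_diff_ennreal tendsto_const tendsto_ennreal_exp_neg lim) auto
    qed simp
    ultimately show "laplace_functional P g = ennreal_exp_neg (\<integral>\<^sup>+y. 1 - ennreal_exp_neg (ennreal (g y)) \<partial>\<nu>)"
      unfolding is_prm_law_laplace_simple[OF prm f(1)] by (rule LIMSEQ_unique)
  qed
qed

lemma is_prm_law_unique:
  assumes "is_prm_law \<nu> P" "is_prm_law \<nu> Q"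
  shows "P = Q"
proof -
  interpret P: laplace_prm \<nu> P using assms(1) by (rule is_prm_law_imp_laplace_prm)
  interpret Q: laplace_prm \<nu> Q using assms(2) by (rule is_prm_law_imp_laplace_prm)
  show ?thesis
    by (rule meas_algebra_eqI_laplace_functional[OF P.P.prob_space_axioms P.sets_P Q.P.prob_space_axioms Q.sets_P])
      (simp only: P.laplace Q.laplace)
qed

section \<open>Existence of Poisson random measures\<close>

text \<open>Only the coordinates in \<open>J\<close> enter the integrand, so the integral may be
  taken over the finite product, which is the image under restriction.\<close>

lemma nn_integral_PiM_prod:
  assumes M: "\<And>i. prob_space (M i)" and J: "finite J" and f: "\<And>i. i \<in> J \<Longrightarrow> f i \<in> borel_measurable (M i)"
  shows "(\<integral>\<^sup>+x. (\<Prod>i\<in>J. f i (x i)) \<partial>PiM UNIV M) = (\<Prod>i\<in>J. integral\<^sup>N (M i) (f i))"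
proof -
  interpret product_prob_space M UNIV
    using M by (simp add: product_prob_space_def product_prob_space_axioms_def product_sigma_finite_def
        prob_space_imp_sigma_finite)
  note f [measurable]
  have "(\<integral>\<^sup>+x. (\<Prod>i\<in>J. f i (x i)) \<partial>PiM UNIV M) = (\<integral>\<^sup>+x. (\<Prod>i\<in>J. f i (restrict x J i)) \<partial>PiM UNIV M)"
    by simp
  also have "\<dots> = (\<integral>\<^sup>+x. (\<Prod>i\<in>J. f i (x i)) \<partial>distr (PiM UNIV M) (PiM J M) (\<lambda>x. restrict x J))"
    using J by (intro nn_integral_distr[symmetric] measurable_restrict_subset) simp_all
  also have "\<dots> = (\<integral>\<^sup>+x. (\<Prod>i\<in>J. f i (x i)) \<partial>PiM J M)"
    using J by (simp only: distr_PiM_restrict_finite subset_UNIV)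
  also have "\<dots> = (\<Prod>i\<in>J. integral\<^sup>N (M i) (f i))"
    using J f by (rule product_nn_integral_prod)
  finally show ?thesis .
qed

text \<open>
  \<open>\<tau> k\<close> is the number of points in the \<open>k\<close>-th cell of a partition, and \<open>X (k, i)\<close> the location of
  the \<open>i\<close>-th of them.
\<close>

definition cell_points :: "'a measure \<Rightarrow> (nat \<Rightarrow> nat) \<times> (nat \<times> nat \<Rightarrow> 'a) \<Rightarrow> 'a measure" where
  "cell_points \<nu> = (\<lambda>(\<tau>, X). distr (count_space {(k, i). i < \<tau> k}) \<nu> X)"

lemma nn_integral_cell_points:
  fixes f :: "'a \<Rightarrow> ennreal"
  assumes X: "\<And>j. X j \<in> space \<nu>" and f: "f \<in> borel_measurable \<nu>"
  shows "(\<integral>\<^sup>+x. f x \<partial>cell_points \<nu> (\<tau>, X)) = (\<Sum>k. \<Sum>i<\<tau> k. f (X (k, i)))"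
proof -
  have "(\<integral>\<^sup>+x. f x \<partial>cell_points \<nu> (\<tau>, X)) = (\<integral>\<^sup>+j. f (X j) \<partial>count_space {(k, i). i < \<tau> k})"
    using X f by (simp add: cell_points_def nn_integral_distr)
  also have "\<dots> = (\<integral>\<^sup>+j. f (X j) * indicator {(k, i). i < \<tau> k} j \<partial>count_space UNIV)"
    by (simp add: nn_integral_count_space_indicator)
  also have "\<dots> = (\<integral>\<^sup>+k. \<integral>\<^sup>+i. f (X (k, i)) * indicator {(k, i). i < \<tau> k} (k, i) \<partial>count_space UNIV \<partial>count_space UNIV)"
    by (rule nn_integral_fst_count_space[symmetric])
  also have "\<dots> = (\<Sum>k. \<Sum>i. f (X (k, i)) * indicator {(k, i). i < \<tau> k} (k, i))"
    by (simp add: nn_integral_count_space_nat)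
  also have "\<dots> = (\<Sum>k. \<Sum>i<\<tau> k. f (X (k, i)))"
  proof (rule suminf_cong)
    fix k
    have "(\<Sum>i. f (X (k, i)) * indicator {(k, i). i < \<tau> k} (k, i))
        = (\<Sum>i<\<tau> k. f (X (k, i)) * indicator {(k, i). i < \<tau> k} (k, i))"
      by (rule suminf_finite) auto
    then show "(\<Sum>i. f (X (k, i)) * indicator {(k, i). i < \<tau> k} (k, i)) = (\<Sum>i<\<tau> k. f (X (k, i)))"
      by simp
  qed
  finally show ?thesis .
qed

lemma ex_laplace_prm:
  assumes "sigma_finite_measure \<nu>" and x0: "x0 \<in> space \<nu>"
  shows "\<exists>P. laplace_prm \<nu> P"
proof -
  interpret sigma_finite_measure \<nu> by fact
  obtain A :: "nat \<Rightarrow> 'a set" where A: "range A \<subseteq> sets \<nu>" "(\<Union>i. A i) = space \<nu>"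
    "\<And>i. emeasure \<nu> (A i) \<noteq> \<infinity>" "disjoint_family A"
    using sigma_finite_disjoint by metis
  have [measurable]: "A k \<in> sets \<nu>" for k using A by auto
  define m where "m k = measure \<nu> (A k)" for k
  have m: "emeasure \<nu> (A k) = ennreal (m k)" "0 \<le> m k" for k
    using A(3)[of k] by (auto simp: m_def emeasure_eq_ennreal_measure)
  \<comment> \<open>The law of a location within a cell. A null cell almost surely receives no
    point, but its locations still need a probability law; the point mass at \<open>x0\<close>
    serves as the default.\<close>
  define \<pi> where "\<pi> k = (if emeasure \<nu> (A k) = 0 then return \<nu> x0 else uniform_measure \<nu> (A k))" for k
  have sets_\<pi>[measurable_cong]: "sets (\<pi> k) = sets \<nu>" for k by (simp add: \<pi>_def)
  have space_\<pi>: "space (\<pi> k) = space \<nu>" for k by (rule sets_eq_imp_space_eq[OF sets_\<pi>])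
  have prob_\<pi>: "prob_space (\<pi> k)" for k
    using A(3)[of k] x0 by (auto simp: \<pi>_def intro!: prob_space_return prob_space_uniform_measure)
  \<comment> \<open>Count intensity times location law is the restriction of \<open>\<nu>\<close> to
    the cell. For null cells both sides are 0, whatever the default law.\<close>
  have int_\<pi>: "ennreal (m k) * (\<integral>\<^sup>+x. f x \<partial>\<pi> k) = (\<integral>\<^sup>+x. f x * indicator (A k) x \<partial>\<nu>)"
    if [measurable]: "f \<in> borel_measurable \<nu>" for f k
  proof (cases "emeasure \<nu> (A k) = 0")
    case True
    then have "AE x in \<nu>. f x * indicator (A k) x = 0"
      by (auto intro!: AE_I[where N = "A k"] simp: indicator_def)
    then have "(\<integral>\<^sup>+x. f x * indicator (A k) x \<partial>\<nu>) = 0"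
      by (simp add: nn_integral_0_iff_AE)
    then show ?thesis using True m(1)[of k] by simp
  next
    case False
    then show ?thesis
      using A(3)[of k] unfolding m(1)[symmetric]
      by (simp add: \<pi>_def nn_integral_uniform_measure ennreal_times_divide ennreal_mult_divide_eq mult.commute[of "emeasure \<nu> (A k)"] less_top)
  qed
  define T where "T = PiM UNIV (\<lambda>k. measure_pmf (poisson0_pmf (m k)))"
  \<comment> \<open>Infinitely many independent locations are drawn in each cell, independently of
    the counts; the count decides how many are used. This keeps the sample space a fixed
    product.\<close>
  define S where "S = PiM UNIV (\<lambda>j::nat \<times> nat. \<pi> (fst j))"
  have prob_T: "prob_space T" unfolding T_def by (intro prob_space_PiM measure_pmf.prob_space_axioms)
  have prob_S: "prob_space S" unfolding S_def by (intro prob_space_PiM prob_\<pi>)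
  interpret T: prob_space T by fact
  interpret S: prob_space S by fact
  interpret TS: pair_prob_space T S ..
  have comp_T [measurable]: "(\<lambda>\<tau>. \<tau> k) \<in> T \<rightarrow>\<^sub>M count_space UNIV" for k
  proof -
    have "(\<lambda>\<tau>. \<tau> k) \<in> T \<rightarrow>\<^sub>M measure_pmf (poisson0_pmf (m k))"
      unfolding T_def by (rule measurable_component_singleton) simp
    then show ?thesis by simp
  qed
  have comp_S [measurable]: "(\<lambda>X. X j) \<in> S \<rightarrow>\<^sub>M \<nu>" for j
  proof -
    have "(\<lambda>X. X j) \<in> S \<rightarrow>\<^sub>M \<pi> (fst j)"
      unfolding S_def by (rule measurable_component_singleton) simp
    then show ?thesis by (simp add: measurable_cong_sets[OF refl sets_\<pi>])
  qed
  have X_space: "X j \<in> space \<nu>" if "X \<in> space S" for X j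
    using that measurable_space[OF comp_S] by blast
  have meas_sum: "(\<lambda>\<omega>. \<Sum>i<fst \<omega> k. f (snd \<omega> (k, i))) \<in> borel_measurable (T \<Otimes>\<^sub>M S)"
    if [measurable]: "f \<in> borel_measurable \<nu>" for f :: "'a \<Rightarrow> ennreal" and k
  proof -
    \<comment> \<open>A sum with a random number of terms becomes a series of measurable terms when
      the condition on \<open>i\<close> is moved into the summand.\<close>
    have "(\<lambda>\<omega>. \<Sum>i. if i < fst \<omega> k then f (snd \<omega> (k, i)) else 0) \<in> borel_measurable (T \<Otimes>\<^sub>M S)"
      by measurable
    also have "(\<lambda>\<omega>. \<Sum>i. if i < fst \<omega> k then f (snd \<omega> (k, i)) else 0)
        = (\<lambda>\<omega>. \<Sum>i<fst \<omega> k. f (snd \<omega> (k, i)))"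
    proof
      fix \<omega> :: "(nat \<Rightarrow> nat) \<times> (nat \<times> nat \<Rightarrow> 'a)"
      have "(\<Sum>i. if i < fst \<omega> k then f (snd \<omega> (k, i)) else 0)
          = (\<Sum>i<fst \<omega> k. if i < fst \<omega> k then f (snd \<omega> (k, i)) else 0)"
        by (rule suminf_finite) auto
      then show "(\<Sum>i. if i < fst \<omega> k then f (snd \<omega> (k, i)) else 0) = (\<Sum>i<fst \<omega> k. f (snd \<omega> (k, i)))"
        by simp
    qed
    finally show ?thesis .
  qed
  let ?N = "cell_points \<nu>"
  have sets_N: "sets (?N \<omega>) = sets \<nu>" for \<omega>
    by (simp add: cell_points_def split: prod.split)
  have int_N: "(\<integral>\<^sup>+x. f x \<partial>?N \<omega>) = (\<Sum>k. \<Sum>i<fst \<omega> k. f (snd \<omega> (k, i)))"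
    if "\<omega> \<in> space (T \<Otimes>\<^sub>M S)" "f \<in> borel_measurable \<nu>" for \<omega> f
    using nn_integral_cell_points[of "snd \<omega>" \<nu> f "fst \<omega>"] that
    by (auto simp: space_pair_measure X_space)
  have meas_N [measurable]: "?N \<in> T \<Otimes>\<^sub>M S \<rightarrow>\<^sub>M meas_algebra \<nu>"
  proof (rule measurable_meas_algebra)
    fix B assume B[measurable]: "B \<in> sets \<nu>"
    have "(\<lambda>\<omega>. \<Sum>k. \<Sum>i<fst \<omega> k. indicator B (snd \<omega> (k, i)) :: ennreal) \<in> borel_measurable (T \<Otimes>\<^sub>M S)"
      by (intro borel_measurable_suminf_order meas_sum) simp
    also have "?this \<longleftrightarrow> (\<lambda>\<omega>. emeasure (?N \<omega>) B) \<in> borel_measurable (T \<Otimes>\<^sub>M S)"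
    proof (rule measurable_cong)
      fix \<omega> assume "\<omega> \<in> space (T \<Otimes>\<^sub>M S)"
      then show "(\<Sum>k. \<Sum>i<fst \<omega> k. indicator B (snd \<omega> (k, i))) = emeasure (?N \<omega>) B"
        using B sets_N[of \<omega>] by (subst int_N[symmetric]) auto
    qed
    finally show "(\<lambda>\<omega>. emeasure (?N \<omega>) B) \<in> borel_measurable (T \<Otimes>\<^sub>M S)" .
  qed (rule sets_N)
  let ?P = "distr (T \<Otimes>\<^sub>M S) (meas_algebra \<nu>) ?N"
  have "laplace_prm \<nu> ?P"
  proof (intro laplace_prm.intro laplace_prm_axioms.intro)
    show "prob_space ?P" by (rule TS.prob_space_distr) measurable
    show "sets ?P = sets (meas_algebra \<nu>)" by simp
    fix g :: "'a \<Rightarrow> real" assume g [measurable]: "g \<in> borel_measurable \<nu>" and g0: "\<And>y. 0 \<le> g y"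
    define \<phi> where "\<phi> y = ennreal_exp_neg (ennreal (g y))" for y
    have \<phi> [measurable]: "\<phi> \<in> borel_measurable \<nu>" unfolding \<phi>_def by measurable
    have \<phi>_le: "\<phi> y \<le> 1" for y by (simp add: \<phi>_def ennreal_exp_neg_le_1)
    have \<phi>\<pi>: "\<phi> \<in> borel_measurable (\<pi> k)" for k
      using \<phi> by (simp add: measurable_cong_sets[OF sets_\<pi> refl])
    define c where "c k = (\<integral>\<^sup>+y. \<phi> y \<partial>\<pi> k)" for k
    have c_le: "c k \<le> 1" for k
    proof -
      have "c k \<le> (\<integral>\<^sup>+y. 1 \<partial>\<pi> k)" unfolding c_def by (intro nn_integral_mono \<phi>_le)
      then show ?thesis by (simp add: prob_space.emeasure_space_1[OF prob_\<pi>])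
    qed
    \<comment> \<open>Brings the exponent left by the Poisson generating function of the
      \<open>k\<close>-th count back to an integral over the \<open>k\<close>-th cell.\<close>
    have one_minus_c: "ennreal (m k) * (1 - c k) = (\<integral>\<^sup>+y. (1 - \<phi> y) * indicator (A k) y \<partial>\<nu>)" for k
    proof -
      have "(\<integral>\<^sup>+y. 1 - \<phi> y \<partial>\<pi> k) = (\<integral>\<^sup>+y. 1 \<partial>\<pi> k) - (\<integral>\<^sup>+y. \<phi> y \<partial>\<pi> k)"
        using c_le[of k] \<phi>_le
        by (intro nn_integral_diff \<phi>\<pi>) (auto simp: c_def top_unique)
      then have "1 - c k = (\<integral>\<^sup>+y. 1 - \<phi> y \<partial>\<pi> k)"
        by (simp add: c_def prob_space.emeasure_space_1[OF prob_\<pi>])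
      then show ?thesis using int_\<pi>[of "\<lambda>y. 1 - \<phi> y" k] by simp
    qed
    \<comment> \<open>Truncation to the first \<open>n\<close> cells: only finitely many coordinates
      enter once the counts are fixed, so the formula for finite products applies. The limit over
      \<open>n\<close> is taken afterwards.\<close>
    let ?F = "\<lambda>n \<omega>. ennreal_exp_neg (\<Sum>k<n. \<Sum>i<fst \<omega> k. ennreal (g (snd \<omega> (k, i))))"
    have F_meas: "?F n \<in> borel_measurable (T \<Otimes>\<^sub>M S)" for n
    proof -
      have "(\<lambda>\<omega>. \<Sum>k<n. \<Sum>i<fst \<omega> k. ennreal (g (snd \<omega> (k, i)))) \<in> borel_measurable (T \<Otimes>\<^sub>M S)"
        by (intro borel_measurable_sum meas_sum) simp
      then show ?thesis by simp
    qed
    have "(\<lambda>n. \<integral>\<^sup>+\<omega>. ?F n \<omega> \<partial>(T \<Otimes>\<^sub>M S)) \<longlonglongrightarrow> (\<integral>\<^sup>+\<omega>. ennreal_exp_neg (\<integral>\<^sup>+y. ennreal (g y) \<partial>?N \<omega>) \<partial>(T \<Otimes>\<^sub>M S))"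
    proof (rule nn_integral_dominated_convergence[where w = "\<lambda>_. 1"])
      show "AE \<omega> in T \<Otimes>\<^sub>M S. (\<lambda>n. ?F n \<omega>) \<longlonglongrightarrow> ennreal_exp_neg (\<integral>\<^sup>+y. ennreal (g y) \<partial>?N \<omega>)"
      proof (rule AE_I2)
        fix \<omega> assume "\<omega> \<in> space (T \<Otimes>\<^sub>M S)"
        then have "(\<integral>\<^sup>+y. ennreal (g y) \<partial>?N \<omega>) = (\<Sum>k. \<Sum>i<fst \<omega> k. ennreal (g (snd \<omega> (k, i))))"
          by (rule int_N) simp
        then show "(\<lambda>n. ?F n \<omega>) \<longlonglongrightarrow> ennreal_exp_neg (\<integral>\<^sup>+y. ennreal (g y) \<partial>?N \<omega>)"
          by (auto intro!: tendsto_ennreal_exp_neg summable_LIMSEQ)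
      qed
      show "(\<lambda>\<omega>. ennreal_exp_neg (\<integral>\<^sup>+y. ennreal (g y) \<partial>?N \<omega>)) \<in> borel_measurable (T \<Otimes>\<^sub>M S)"
        by measurable
    qed (auto simp: F_meas ennreal_exp_neg_le_1 TS.emeasure_space_1)
    also have "(\<integral>\<^sup>+\<omega>. ennreal_exp_neg (\<integral>\<^sup>+y. ennreal (g y) \<partial>?N \<omega>) \<partial>(T \<Otimes>\<^sub>M S)) = laplace_functional ?P g"
      unfolding laplace_functional_def by (rule nn_integral_distr[symmetric]) measurable
    finally have lim1: "(\<lambda>n. \<integral>\<^sup>+\<omega>. ?F n \<omega> \<partial>(T \<Otimes>\<^sub>M S)) \<longlonglongrightarrow> laplace_functional ?P g" .
    have F_int: "(\<integral>\<^sup>+\<omega>. ?F n \<omega> \<partial>(T \<Otimes>\<^sub>M S))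
        = ennreal_exp_neg (\<Sum>k<n. \<integral>\<^sup>+y. (1 - \<phi> y) * indicator (A k) y \<partial>\<nu>)" for n
    proof -
      have "(\<integral>\<^sup>+\<omega>. ?F n \<omega> \<partial>(T \<Otimes>\<^sub>M S)) = (\<integral>\<^sup>+\<tau>. \<integral>\<^sup>+X. ?F n (\<tau>, X) \<partial>S \<partial>T)"
        using F_meas by (rule S.nn_integral_fst[symmetric])
      also have "\<dots> = (\<integral>\<^sup>+\<tau>. (\<Prod>k<n. c k ^ \<tau> k) \<partial>T)"
      proof (rule nn_integral_cong)
        fix \<tau> :: "nat \<Rightarrow> nat"
        \<comment> \<open>For fixed counts these are the labels of the points in use. Each of the
          \<open>\<tau> k\<close> points of cell \<open>k\<close> contributes an independent factor
          with mean \<open>c k\<close>.\<close>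
        let ?J = "Sigma {..<n} (\<lambda>k. {..<\<tau> k})"
        have "(\<integral>\<^sup>+X. ?F n (\<tau>, X) \<partial>S) = (\<integral>\<^sup>+X. (\<Prod>j\<in>?J. \<phi> (X j)) \<partial>S)"
          by (simp add: ennreal_exp_neg_sum prod.Sigma \<phi>_def split_def)
        also have "\<dots> = (\<Prod>j\<in>?J. \<integral>\<^sup>+y. \<phi> y \<partial>\<pi> (fst j))"
          unfolding S_def by (rule nn_integral_PiM_prod) (auto intro: prob_\<pi> \<phi>\<pi>)
        also have "\<dots> = (\<Prod>k<n. c k ^ \<tau> k)"
          by (subst prod.Sigma[symmetric, where g = "\<lambda>k i. \<integral>\<^sup>+y. \<phi> y \<partial>\<pi> k", unfolded split_def])
            (auto simp: c_def)
        finally show "(\<integral>\<^sup>+X. ?F n (\<tau>, X) \<partial>S) = (\<Prod>k<n. c k ^ \<tau> k)" .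
      qed
      also have "\<dots> = (\<Prod>k<n. \<integral>\<^sup>+t. c k ^ t \<partial>measure_pmf (poisson0_pmf (m k)))"
        unfolding T_def by (rule nn_integral_PiM_prod) (auto intro: measure_pmf.prob_space_axioms)
      also have "\<dots> = ennreal_exp_neg (\<Sum>k<n. ennreal (m k) * (1 - c k))"
        by (simp add: nn_integral_poisson0_power m c_le ennreal_exp_neg_sum)
      finally show ?thesis by (simp add: one_minus_c)
    qed
    have "(\<Sum>k. \<integral>\<^sup>+y. (1 - \<phi> y) * indicator (A k) y \<partial>\<nu>) = (\<integral>\<^sup>+y. (\<Sum>k. (1 - \<phi> y) * indicator (A k) y) \<partial>\<nu>)"
      by (rule nn_integral_suminf[symmetric]) measurable
    also have "\<dots> = (\<integral>\<^sup>+y. 1 - \<phi> y \<partial>\<nu>)"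
      using A(2,4) by (intro nn_integral_cong) (auto simp: suminf_indicator)
    finally have sum: "(\<Sum>k. \<integral>\<^sup>+y. (1 - \<phi> y) * indicator (A k) y \<partial>\<nu>) = (\<integral>\<^sup>+y. 1 - \<phi> y \<partial>\<nu>)" .
    have lim2: "(\<lambda>n. ennreal_exp_neg (\<Sum>k<n. \<integral>\<^sup>+y. (1 - \<phi> y) * indicator (A k) y \<partial>\<nu>))
        \<longlonglongrightarrow> ennreal_exp_neg (\<integral>\<^sup>+y. 1 - \<phi> y \<partial>\<nu>)"
      unfolding sum[symmetric] by (intro tendsto_ennreal_exp_neg summable_LIMSEQ summableI)
    show "laplace_functional ?P g = ennreal_exp_neg (\<integral>\<^sup>+y. 1 - ennreal_exp_neg (ennreal (g y)) \<partial>\<nu>)"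
      using lim1 lim2 unfolding F_int \<phi>_def by (rule LIMSEQ_unique)
  qed
  then show ?thesis ..
qed

text \<open>Existence and uniqueness together discharge the definite description in
  \<open>prm_law\<close>.\<close>

lemma laplace_prm_prm_law:
  assumes "sigma_finite_measure \<nu>" "x0 \<in> space \<nu>"
  shows "laplace_prm \<nu> (prm_law \<nu>)"
proof -
  obtain P where P: "is_prm_law \<nu> P"
    using ex_laplace_prm[OF assms] laplace_prm.is_prm_law by blast
  have "is_prm_law \<nu> (prm_law \<nu>)"
    unfolding prm_law_def by (rule theI[of "is_prm_law \<nu>" P, OF P is_prm_law_unique[OF _ P]])
  then show ?thesis by (rule is_prm_law_imp_laplace_prm)
qed

section \<open>Completely random measures and the generalized gamma exponent\<close>

text \<open>The substitution \<open>t = x s\<close> in the Gamma integral.\<close>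

lemma nn_integral_powr_exp:
  assumes a: "0 < a" and x: "0 < x"
  shows "(\<integral>\<^sup>+s. (if 0 < s then ennreal (s powr (a - 1) * exp (- (x * s))) else 0) \<partial>lborel)
    = ennreal (Gamma a * x powr (- a))"
proof -
  have "ennreal (Gamma a) = (\<integral>\<^sup>+t. ennreal (indicator {0..} t * t powr (a - 1) / exp t) \<partial>lborel)"
    by (rule Gamma_conv_nn_integral_real[OF a])
  also have "\<dots> = ennreal \<bar>x\<bar> * (\<integral>\<^sup>+s. ennreal (indicator {0..} (0 + x * s) * (0 + x * s) powr (a - 1) / exp (0 + x * s)) \<partial>lborel)"
    using x by (intro nn_integral_real_affine) auto
  also have "(\<integral>\<^sup>+s. ennreal (indicator {0..} (0 + x * s) * (0 + x * s) powr (a - 1) / exp (0 + x * s)) \<partial>lborel)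
      = (\<integral>\<^sup>+s. ennreal (x powr (a - 1)) * (if 0 < s then ennreal (s powr (a - 1) * exp (- (x * s))) else 0) \<partial>lborel)"
  proof (rule nn_integral_cong)
    fix s :: real
    show "ennreal (indicator {0..} (0 + x * s) * (0 + x * s) powr (a - 1) / exp (0 + x * s))
        = ennreal (x powr (a - 1)) * (if 0 < s then ennreal (s powr (a - 1) * exp (- (x * s))) else 0)"
      using x by (cases "s = 0")
        (auto simp: indicator_def zero_le_mult_iff powr_mult exp_minus field_simps simp flip: ennreal_mult)
  qed
  also have "\<dots> = ennreal (x powr (a - 1)) * (\<integral>\<^sup>+s. (if 0 < s then ennreal (s powr (a - 1) * exp (- (x * s))) else 0) \<partial>lborel)"
    by (rule nn_integral_cmult) measurable
  finally have *: "ennreal (Gamma a) = ennreal (x powr a)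
      * (\<integral>\<^sup>+s. (if 0 < s then ennreal (s powr (a - 1) * exp (- (x * s))) else 0) \<partial>lborel)" (is "_ = _ * ?I")
    using x by (simp add: mult.assoc[symmetric] ennreal_mult[symmetric] powr_mult_base)
  \<comment> \<open>Multiplying by the inverse power, which is finite and positive, isolates
    \<open>?I\<close> without knowing in advance that it is finite.\<close>
  have "?I = ennreal (x powr (- a)) * (ennreal (x powr a) * ?I)"
    using x by (simp add: mult.assoc[symmetric] ennreal_mult[symmetric] powr_minus)
  also have "\<dots> = ennreal (Gamma a * x powr (- a))"
    using a by (simp only: *[symmetric]) (simp add: ennreal_mult[symmetric] Gamma_real_pos less_imp_le mult.commute)
  finally show ?thesis .
qed

lemma sets_gg_levy [simp, measurable_cong]: "sets (gg_levy \<alpha> b) = sets borel"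
  by (simp add: gg_levy_def)

lemma sigma_finite_gg_levy: "sigma_finite_measure (gg_levy \<alpha> b)"
  unfolding gg_levy_def by (subst sigma_finite_measure.sigma_finite_iff_density_finite[OF sigma_finite_lborel]) auto

lemma nn_integral_powr_Icc:
  assumes "0 < \<alpha>" "0 \<le> b" "0 \<le> g"
  shows "(\<integral>\<^sup>+u. ennreal (u powr (\<alpha> - 1)) * indicator {b..b + g} u \<partial>lborel)
    = ennreal (((b + g) powr \<alpha> - b powr \<alpha>) / \<alpha>)"
proof (rule nn_integral_has_integral_lebesgue')
  have "((\<lambda>u. u powr (\<alpha> - 1)) has_integral (b + g) powr \<alpha> / \<alpha> - b powr \<alpha> / \<alpha>) {b..b + g}"
  \<comment> \<open>Differentiability is required only in the interior: for \<open>b = 0\<close> and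
    \<open>\<alpha> < 1\<close> the integrand is unbounded at the left end.\<close>
  proof (rule fundamental_theorem_of_calculus_interior)
    show "continuous_on {b..b + g} (\<lambda>u. u powr \<alpha> / \<alpha>)"
      using assms by (auto intro!: continuous_intros continuous_on_powr')
    fix u assume "u \<in> {b<..<b + g}"
    then have "0 < u" using assms by auto
    then show "((\<lambda>u. u powr \<alpha> / \<alpha>) has_vector_derivative u powr (\<alpha> - 1)) (at u)"
      using assms DERIV_cdivide[OF has_real_derivative_powr[of u \<alpha>], of \<alpha>]
      by (simp add: has_real_derivative_iff_has_vector_derivative)
  qed (use assms in simp)
  then show "((\<lambda>u. u powr (\<alpha> - 1)) has_integral ((b + g) powr \<alpha> - b powr \<alpha>) / \<alpha>) {b..b + g}"
    by (simp add: diff_divide_distrib)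
qed simp

text \<open>Write \<open>exp(-bs) (1 - exp(-gs))\<close> as the integral of
  \<open>s exp(-us)\<close> over \<open>u\<close> in \<open>[b, b+g]\<close> and exchange the
  integrals. The extra \<open>s\<close> tames the singularity at 0: the inner integral becomes
  \<open>Gamma(1 - \<alpha>) u^(\<alpha> - 1)\<close>, and the normalisation of the Levy density
  cancels the Gamma value.\<close>

lemma gg_levy_laplace_exponent:
  assumes \<alpha>: "0 < \<alpha>" "\<alpha> < 1" and b: "0 \<le> b" and g: "0 \<le> g"
  shows "(\<integral>\<^sup>+s. 1 - ennreal_exp_neg (ennreal (max 0 s * g)) \<partial>gg_levy \<alpha> b)
    = ennreal (((b + g) powr \<alpha> - b powr \<alpha>) / \<alpha>)"
proof -
  have G: "0 < Gamma (1 - \<alpha>)" using \<alpha> by (intro Gamma_real_pos) auto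
  let ?k = "\<lambda>s u. (if 0 < s then ennreal (1 / Gamma (1 - \<alpha>) * s powr (- \<alpha>) * exp (- (u * s))) else 0)
    * indicator {b..b + g} u"
  have "(\<integral>\<^sup>+s. 1 - ennreal_exp_neg (ennreal (max 0 s * g)) \<partial>gg_levy \<alpha> b)
      = (\<integral>\<^sup>+s. (if 0 < s then ennreal (1 / Gamma (1 - \<alpha>) * s powr (- \<alpha> - 1) * exp (- b * s)) else 0)
          * (1 - ennreal_exp_neg (ennreal (max 0 s * g))) \<partial>lborel)"
    unfolding gg_levy_def by (rule nn_integral_density) measurable
  also have "\<dots> = (\<integral>\<^sup>+s. \<integral>\<^sup>+u. ?k s u \<partial>lborel \<partial>lborel)"
  proof (rule nn_integral_cong)
    fix s :: real
    show "(if 0 < s then ennreal (1 / Gamma (1 - \<alpha>) * s powr (- \<alpha> - 1) * exp (- b * s)) else 0)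
          * (1 - ennreal_exp_neg (ennreal (max 0 s * g))) = (\<integral>\<^sup>+u. ?k s u \<partial>lborel)"
    proof (cases "0 < s")
      case True
      have "(\<integral>\<^sup>+u. ennreal (s * exp (- (u * s))) * indicator {b..b + g} u \<partial>lborel)
          = ennreal (- exp (- ((b + g) * s)) - - exp (- (b * s)))"
        using True g by (intro nn_integral_FTC_Icc) (auto intro!: derivative_eq_intros)
      then have I: "(\<integral>\<^sup>+u. ennreal (s * exp (- (u * s))) * indicator {b..b + g} u \<partial>lborel)
          = ennreal (exp (- (b * s)) - exp (- ((b + g) * s)))" by simp
      have "(\<integral>\<^sup>+u. ?k s u \<partial>lborel)
          = (\<integral>\<^sup>+u. ennreal (1 / Gamma (1 - \<alpha>) * s powr (- \<alpha> - 1))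
              * (ennreal (s * exp (- (u * s))) * indicator {b..b + g} u) \<partial>lborel)"
      proof (rule nn_integral_cong)
        fix u :: real
        have "s powr (- \<alpha>) = s powr (- \<alpha> - 1) * s" using True by (simp add: powr_diff)
        then show "?k s u = ennreal (1 / Gamma (1 - \<alpha>) * s powr (- \<alpha> - 1))
              * (ennreal (s * exp (- (u * s))) * indicator {b..b + g} u)"
          using True G by (auto simp: indicator_def mult_ac simp flip: ennreal_mult)
      qed
      also have "\<dots> = ennreal (1 / Gamma (1 - \<alpha>) * s powr (- \<alpha> - 1)) * ennreal (exp (- (b * s)) - exp (- ((b + g) * s)))"
        by (subst nn_integral_cmult) (auto simp: I)
      also have "\<dots> = ennreal (1 / Gamma (1 - \<alpha>) * s powr (- \<alpha> - 1)) * ennreal (exp (- (b * s)) * (1 - exp (- (s * g))))"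
        by (simp add: algebra_simps exp_add[symmetric])
      also have "\<dots> = ennreal (1 / Gamma (1 - \<alpha>) * s powr (- \<alpha> - 1) * exp (- b * s)) * (1 - ennreal (exp (- (s * g))))"
      proof -
        have "1 - ennreal (exp (- (s * g))) = ennreal (1 - exp (- (s * g)))"
          using True g by (simp add: ennreal_minus[symmetric] flip: ennreal_1)
        then show ?thesis
          using True g G by (simp add: mult_ac flip: ennreal_mult)
      qed
      finally show ?thesis using True g by (simp add: ennreal_exp_neg_ennreal)
    qed simp
  qed
  also have "\<dots> = (\<integral>\<^sup>+u. \<integral>\<^sup>+s. ?k s u \<partial>lborel \<partial>lborel)"
    by (rule lborel_pair.Fubini'[symmetric]) measurable
  also have "\<dots> = (\<integral>\<^sup>+u. ennreal (u powr (\<alpha> - 1)) * indicator {b..b + g} u \<partial>lborel)"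
  proof (rule nn_integral_cong_AE)
    \<comment> \<open>The point \<open>u = 0\<close>, which lies in the range when
      \<open>b = 0\<close>, has to be excluded: there the inner integral diverges, whereas
      \<open>0 powr (\<alpha> - 1)\<close> is 0 by convention.\<close>
    have "AE u in lborel. u \<noteq> (0::real)" by (rule AE_lborel_singleton)
    then show "AE u in lborel. (\<integral>\<^sup>+s. ?k s u \<partial>lborel) = ennreal (u powr (\<alpha> - 1)) * indicator {b..b + g} u"
    proof eventually_elim
      case (elim u)
      show ?case
      proof (cases "u \<in> {b..b + g}")
        case True
        then have u: "0 < u" using elim b by auto
        have "(\<integral>\<^sup>+s. ?k s u \<partial>lborel) = (\<integral>\<^sup>+s. ennreal (1 / Gamma (1 - \<alpha>))
            * (if 0 < s then ennreal (s powr ((1 - \<alpha>) - 1) * exp (- (u * s))) else 0) \<partial>lborel)"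
          using True G by (intro nn_integral_cong) (auto simp: mult.assoc simp flip: ennreal_mult)
        also have "\<dots> = ennreal (1 / Gamma (1 - \<alpha>)) * ennreal (Gamma (1 - \<alpha>) * u powr (- (1 - \<alpha>)))"
          using \<alpha> u by (subst nn_integral_cmult) (simp_all only: nn_integral_powr_exp, auto)
        also have "\<dots> = ennreal (u powr (\<alpha> - 1))"
          using G by (simp flip: ennreal_mult)
        finally show ?thesis using True by simp
      qed simp
    qed
  qed
  also have "\<dots> = ennreal (((b + g) powr \<alpha> - b powr \<alpha>) / \<alpha>)"
    using \<alpha>(1) b g by (rule nn_integral_powr_Icc)
  finally show ?thesis .
qed

section \<open>From Poisson points to completely random measures\<close>

lemma sets_jump_integral [simp]: "sets (jump_integral N) = sets borel"
  by (simp add: jump_integral_def)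

lemma nn_integral_jump_integral:
  fixes N :: "(real \<times> 'y::topological_space) measure"
  assumes N: "sets N = sets (borel \<Otimes>\<^sub>M borel)" and [measurable]: "f \<in> borel_measurable borel"
  shows "(\<integral>\<^sup>+y. f y \<partial>jump_integral N) = (\<integral>\<^sup>+(s, y). ennreal s * f y \<partial>N)"
proof -
  note [measurable_cong] = N
  have [measurable]: "snd \<in> density N (\<lambda>(s, y). ennreal s) \<rightarrow>\<^sub>M (borel :: 'y measure)"
    by measurable
  have "(\<integral>\<^sup>+y. f y \<partial>jump_integral N) = (\<integral>\<^sup>+x. f (snd x) \<partial>density N (\<lambda>(s, y). ennreal s))"
    unfolding jump_integral_def by (rule nn_integral_distr) measurable
  also have "\<dots> = (\<integral>\<^sup>+x. (case x of (s, y) \<Rightarrow> ennreal s) * f (snd x) \<partial>N)"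
    by (rule nn_integral_density) measurable
  finally show ?thesis by (simp add: split_def)
qed

lemma measurable_jump_integral:
  "jump_integral \<in> meas_algebra (borel \<Otimes>\<^sub>M borel) \<rightarrow>\<^sub>M meas_algebra (borel :: 'y::topological_space measure)"
proof (rule measurable_meas_algebra)
  fix A :: "'y set" assume A [measurable]: "A \<in> sets borel"
  have "(\<lambda>N. \<integral>\<^sup>+(s, y). ennreal s * indicator A y \<partial>N) \<in> borel_measurable (meas_algebra (borel \<Otimes>\<^sub>M borel))"
    by measurable
  also have "?this \<longleftrightarrow> (\<lambda>N. emeasure (jump_integral N) A) \<in> borel_measurable (meas_algebra (borel \<Otimes>\<^sub>M borel))"
  proof (rule measurable_cong)
    fix N :: "(real \<times> 'y) measure"
    assume "N \<in> space (meas_algebra (borel \<Otimes>\<^sub>M borel))"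
    then have "sets N = sets (borel \<Otimes>\<^sub>M borel)" by (simp add: space_meas_algebra)
    from nn_integral_jump_integral[OF this, of "indicator A"]
    show "(\<integral>\<^sup>+(s, y). ennreal s * indicator A y \<partial>N) = emeasure (jump_integral N) A"
      by simp
  qed
  finally show "(\<lambda>N. emeasure (jump_integral N) A) \<in> borel_measurable (meas_algebra (borel \<Otimes>\<^sub>M borel))" .
qed simp

lemma sets_crm_law [simp, measurable_cong]: "sets (crm_law \<rho> \<eta>) = sets (meas_algebra borel)"
  by (simp add: crm_law_def)

context
  fixes \<rho> :: "real measure" and \<eta> :: "'y::topological_space measure"
  assumes \<rho>: "sigma_finite_measure \<rho>" "sets \<rho> = sets borel"
    and \<eta>: "sigma_finite_measure \<eta>" "sets \<eta> = sets borel"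
begin

lemma laplace_prm_pair: "laplace_prm (\<rho> \<Otimes>\<^sub>M \<eta>) (prm_law (\<rho> \<Otimes>\<^sub>M \<eta>))"
proof (rule laplace_prm_prm_law)
  show "sigma_finite_measure (\<rho> \<Otimes>\<^sub>M \<eta>)"
    using \<rho>(1) \<eta>(1) by (rule sigma_finite_pair_measure)
  show "undefined \<in> space (\<rho> \<Otimes>\<^sub>M \<eta>)"
    using sets_eq_imp_space_eq[OF \<rho>(2)] sets_eq_imp_space_eq[OF \<eta>(2)]
    by (simp add: space_pair_measure)
qed

lemma sets_intensity: "sets (\<rho> \<Otimes>\<^sub>M \<eta>) = sets (borel \<Otimes>\<^sub>M borel)"
  using \<rho>(2) \<eta>(2) by (rule sets_pair_measure_cong)

lemma measurable_jump_integral_prm: "jump_integral \<in> prm_law (\<rho> \<Otimes>\<^sub>M \<eta>) \<rightarrow>\<^sub>M meas_algebra borel"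
  using measurable_jump_integral
  by (simp add: measurable_cong_sets[OF laplace_prm.sets_P[OF laplace_prm_pair] refl]
      meas_algebra_cong[OF sets_intensity])

lemma prob_space_crm_law: "prob_space (crm_law \<rho> \<eta>)"
proof -
  interpret laplace_prm "\<rho> \<Otimes>\<^sub>M \<eta>" "prm_law (\<rho> \<Otimes>\<^sub>M \<eta>)" by (rule laplace_prm_pair)
  show ?thesis
    unfolding crm_law_def by (rule P.prob_space_distr[OF measurable_jump_integral_prm])
qed

text \<open>\<open>mu(g)\<close> is the integral of \<open>s g(y)\<close> against the Poisson random
  measure, so this is the Poisson functional at the test function \<open>s g(y)\<close>.\<close>

lemma laplace_functional_crm_law:
  assumes g [measurable]: "g \<in> borel_measurable borel" and g0: "\<And>y. 0 \<le> g y"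
  shows "laplace_functional (crm_law \<rho> \<eta>) g
    = ennreal_exp_neg (\<integral>\<^sup>+y. \<integral>\<^sup>+s. 1 - ennreal_exp_neg (ennreal (max 0 s * g y)) \<partial>\<rho> \<partial>\<eta>)"
proof -
  interpret laplace_prm "\<rho> \<Otimes>\<^sub>M \<eta>" "prm_law (\<rho> \<Otimes>\<^sub>M \<eta>)" by (rule laplace_prm_pair)
  interpret \<rho>: sigma_finite_measure \<rho> by (rule \<rho>)
  interpret \<eta>: sigma_finite_measure \<eta> by (rule \<eta>)
  interpret pair_sigma_finite \<rho> \<eta> ..
  note [measurable_cong] = \<rho>(2) \<eta>(2)
  \<comment> \<open>The Poisson formula asks for a test function that is nonnegative on the whole
    product space. Clipping at 0 achieves this and changes nothing, since \<open>ennreal s\<close>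
    is 0 for negative \<open>s\<close>.\<close>
  let ?g = "\<lambda>x. max 0 (fst x) * g (snd x)"
  have "laplace_functional (crm_law \<rho> \<eta>) g
      = (\<integral>\<^sup>+N. ennreal_exp_neg (\<integral>\<^sup>+y. ennreal (g y) \<partial>jump_integral N) \<partial>prm_law (\<rho> \<Otimes>\<^sub>M \<eta>))"
    unfolding laplace_functional_def crm_law_def
    by (rule nn_integral_distr[OF measurable_jump_integral_prm]) measurable
  also have "\<dots> = laplace_functional (prm_law (\<rho> \<Otimes>\<^sub>M \<eta>)) ?g"
    unfolding laplace_functional_def
  proof (rule nn_integral_cong)
    fix N :: "(real \<times> 'y) measure"
    assume "N \<in> space (prm_law (\<rho> \<Otimes>\<^sub>M \<eta>))"
    then have "sets N = sets (borel \<Otimes>\<^sub>M borel)" by (simp add: space_P sets_intensity)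
    then have "(\<integral>\<^sup>+y. ennreal (g y) \<partial>jump_integral N) = (\<integral>\<^sup>+(s, y). ennreal s * ennreal (g y) \<partial>N)"
      by (rule nn_integral_jump_integral) measurable
    also have "\<dots> = (\<integral>\<^sup>+x. ennreal (?g x) \<partial>N)"
    proof (rule nn_integral_cong)
      fix x :: "real \<times> 'y"
      have "ennreal (fst x) = ennreal (max 0 (fst x))" by (auto simp: max_def ennreal_neg)
      then show "(case x of (s, y) \<Rightarrow> ennreal s * ennreal (g y)) = ennreal (?g x)"
        using g0 by (simp add: split_def ennreal_mult)
    qed
    finally show "ennreal_exp_neg (\<integral>\<^sup>+y. ennreal (g y) \<partial>jump_integral N)
        = ennreal_exp_neg (\<integral>\<^sup>+x. ennreal (?g x) \<partial>N)" by simp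
  qed
  also have "\<dots> = ennreal_exp_neg (\<integral>\<^sup>+x. 1 - ennreal_exp_neg (ennreal (?g x)) \<partial>(\<rho> \<Otimes>\<^sub>M \<eta>))"
    using g0 by (intro laplace) auto
  also have "(\<integral>\<^sup>+x. 1 - ennreal_exp_neg (ennreal (?g x)) \<partial>(\<rho> \<Otimes>\<^sub>M \<eta>))
      = (\<integral>\<^sup>+y. \<integral>\<^sup>+s. 1 - ennreal_exp_neg (ennreal (max 0 s * g y)) \<partial>\<rho> \<partial>\<eta>)"
    by (subst nn_integral_snd[symmetric]) auto
  finally show ?thesis .
qed

end

section \<open>Exponential tilting and gamma mixtures\<close>

lemma sets_gamma_law [simp, measurable_cong]: "sets (gamma_law a b) = sets borel"
  by (simp add: gamma_law_def)

lemma space_gamma_law [simp]: "space (gamma_law a b) = UNIV"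
  by (simp add: gamma_law_def)

lemma nn_integral_gamma_law:
  assumes "0 < a" and [measurable]: "f \<in> borel_measurable borel"
  shows "(\<integral>\<^sup>+x. f x \<partial>gamma_law a b) = ennreal (b powr a / Gamma a) *
    (\<integral>\<^sup>+x. (if 0 < x then ennreal (x powr (a - 1) * exp (- b * x)) * f x else 0) \<partial>lborel)"
proof -
  have "(\<integral>\<^sup>+x. f x \<partial>gamma_law a b) = (\<integral>\<^sup>+x. (if 0 < x
      then ennreal (b powr a / Gamma a * x powr (a - 1) * exp (- b * x)) else 0) * f x \<partial>lborel)"
    unfolding gamma_law_def by (rule nn_integral_density) measurable
  also have "\<dots> = (\<integral>\<^sup>+x. ennreal (b powr a / Gamma a) *
      (if 0 < x then ennreal (x powr (a - 1) * exp (- b * x)) * f x else 0) \<partial>lborel)"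
    using Gamma_real_pos[OF \<open>0 < a\<close>]
    by (intro nn_integral_cong) (simp add: mult.assoc[symmetric] ennreal_mult[symmetric])
  also have "\<dots> = ennreal (b powr a / Gamma a) *
    (\<integral>\<^sup>+x. (if 0 < x then ennreal (x powr (a - 1) * exp (- b * x)) * f x else 0) \<partial>lborel)"
    by (rule nn_integral_cmult) measurable
  finally show ?thesis .
qed

lemma AE_gamma_law: "AE x in gamma_law a b. 0 < x"
  unfolding gamma_law_def by (subst AE_density) auto

lemma nn_integral_gamma_law_cong:
  assumes "\<And>x. 0 < x \<Longrightarrow> f x = g x"
  shows "(\<integral>\<^sup>+x. f x \<partial>gamma_law a b) = (\<integral>\<^sup>+x. g x \<partial>gamma_law a b)"
  using AE_gamma_law[of a b] by (intro nn_integral_cong_AE) (auto elim!: eventually_mono intro: assms)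

lemma prob_space_gamma_law:
  assumes "0 < a" "0 < b"
  shows "prob_space (gamma_law a b)"
proof (rule prob_spaceI)
  have "emeasure (gamma_law a b) (space (gamma_law a b)) = (\<integral>\<^sup>+x. 1 \<partial>gamma_law a b)"
    by simp
  also have "\<dots> = ennreal (b powr a / Gamma a) *
    (\<integral>\<^sup>+x. (if 0 < x then ennreal (x powr (a - 1) * exp (- (b * x))) else 0) \<partial>lborel)"
    using assms by (subst nn_integral_gamma_law) (auto cong: if_cong)
  also have "\<dots> = 1"
    using assms less_imp_neq[OF Gamma_real_pos[OF assms(1)]]
    by (subst nn_integral_powr_exp) (auto simp: powr_minus ennreal_mult[symmetric])
  finally show "emeasure (gamma_law a b) (space (gamma_law a b)) = 1" .
qed

section \<open>The mixing integral and its power law\<close>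

text \<open>What remains of the gamma mixture of the tilting densities after \<open>exp(K L)\<close>
  and \<open>exp(-K L)\<close> cancel. For \<open>T > 0\<close> and
  \<open>\<alpha>, \<theta> > 0\<close> the substitution \<open>x = L^(1/\<alpha>)\<close>
  identifies it as \<open>\<alpha> Gamma(\<theta>) T^(-\<theta>)\<close>; only the dependence on
  \<open>T\<close> is used.\<close>

definition gg_power_integral :: "real \<Rightarrow> real \<Rightarrow> ennreal \<Rightarrow> ennreal" where
  "gg_power_integral \<alpha> \<theta> T = (\<integral>\<^sup>+L. (if 0 < L then ennreal (L powr (\<theta> / \<alpha> - 1))
     * ennreal_exp_neg (ennreal (L powr (1 / \<alpha>)) * T) else 0) \<partial>lborel)"

text \<open>Replacing \<open>L\<close> by \<open>t^(-\<alpha>) L\<close> removes \<open>t\<close>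
  from the exponential; the Jacobian and the power of \<open>L\<close> together give
  \<open>t^(-\<alpha>)\<close> to the power \<open>\<theta>/\<alpha>\<close>.\<close>

lemma gg_power_integral_scale:
  assumes \<alpha>: "0 < \<alpha>" and t: "0 < t"
  shows "gg_power_integral \<alpha> \<theta> (ennreal t * T) = ennreal (t powr (- \<theta>)) * gg_power_integral \<alpha> \<theta> T"
proof -
  let ?c = "t powr (- \<alpha>)"
  have c: "0 < ?c" using t by simp
  have "gg_power_integral \<alpha> \<theta> (ennreal t * T)
      = ennreal \<bar>?c\<bar> * (\<integral>\<^sup>+L. (if 0 < 0 + ?c * L then ennreal ((0 + ?c * L) powr (\<theta> / \<alpha> - 1))
         * ennreal_exp_neg (ennreal ((0 + ?c * L) powr (1 / \<alpha>)) * (ennreal t * T)) else 0) \<partial>lborel)"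
    unfolding gg_power_integral_def using c by (intro nn_integral_real_affine) auto
  also have "\<dots> = ennreal ?c * (\<integral>\<^sup>+L. ennreal (?c powr (\<theta> / \<alpha> - 1)) * (if 0 < L then ennreal (L powr (\<theta> / \<alpha> - 1))
         * ennreal_exp_neg (ennreal (L powr (1 / \<alpha>)) * T) else 0) \<partial>lborel)"
  proof (intro arg_cong2[where f = "(*)"] nn_integral_cong)
    fix L :: real
    have "(?c * L) powr (1 / \<alpha>) * t = L powr (1 / \<alpha>)" if "0 < L"
    proof -
      have "?c powr (1 / \<alpha>) = 1 / t" using \<alpha> t powr_minus_divide[of t 1] by (simp add: powr_powr)
      then show ?thesis using that c t by (simp add: powr_mult)
    qed
    then have e: "ennreal ((?c * L) powr (1 / \<alpha>)) * (ennreal t * T) = ennreal (L powr (1 / \<alpha>)) * T" if "0 < L"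
      using that t by (simp add: mult.assoc[symmetric] ennreal_mult[symmetric])
    have f: "(?c * L) powr (\<theta> / \<alpha> - 1) = ?c powr (\<theta> / \<alpha> - 1) * L powr (\<theta> / \<alpha> - 1)" if "0 < L"
      using that c by (simp add: powr_mult)
    show "(if 0 < 0 + ?c * L then ennreal ((0 + ?c * L) powr (\<theta> / \<alpha> - 1))
         * ennreal_exp_neg (ennreal ((0 + ?c * L) powr (1 / \<alpha>)) * (ennreal t * T)) else 0)
       = ennreal (?c powr (\<theta> / \<alpha> - 1)) * (if 0 < L then ennreal (L powr (\<theta> / \<alpha> - 1))
         * ennreal_exp_neg (ennreal (L powr (1 / \<alpha>)) * T) else 0)"
      using c by (cases "0 < L")
        (simp_all add: e f zero_less_mult_iff ennreal_mult mult.assoc)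
  qed (use c in simp)
  also have "\<dots> = ennreal (?c * ?c powr (\<theta> / \<alpha> - 1)) * gg_power_integral \<alpha> \<theta> T"
    unfolding gg_power_integral_def using c
    by (subst nn_integral_cmult) (auto simp: mult.assoc ennreal_mult)
  also have "?c * ?c powr (\<theta> / \<alpha> - 1) = t powr (- \<theta>)"
    using \<alpha> t c powr_mult_base[of ?c "\<theta> / \<alpha> - 1"] by (simp add: powr_powr)
  finally show ?thesis .
qed

lemma gg_power_integral_pos:
  assumes "T \<noteq> \<infinity>"
  shows "0 < gg_power_integral \<alpha> \<theta> T"
proof (rule ccontr)
  assume "\<not> ?thesis"
  then have "gg_power_integral \<alpha> \<theta> T = 0" by (simp add: not_gr_zero)
  then have "AE L in lborel. (if 0 < L then ennreal (L powr (\<theta> / \<alpha> - 1))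
     * ennreal_exp_neg (ennreal (L powr (1 / \<alpha>)) * T) else 0) = 0"
    unfolding gg_power_integral_def by (subst (asm) nn_integral_0_iff_AE) measurable
  then have "AE L in lborel. L \<notin> {0<..<1::real}"
    using assms by (auto elim!: eventually_mono simp: ennreal_exp_neg_eq_0_iff ennreal_mult_eq_top_iff split: if_splits)
  then have "{0<..<1::real} \<in> null_sets lborel"
    by (subst AE_iff_null_sets) simp_all
  then show False by (simp add: null_sets_def)
qed

text \<open>Scaling from \<open>T = 1\<close> covers positive finite \<open>T\<close>. The values at
  0 and \<open>\<infinity>\<close> are included, so the mixture and \<open>T^(-\<theta>)\<close> can
  be compared for every measure and not only almost surely.\<close>

lemma gg_power_integral_eq:
  assumes \<alpha>: "0 < \<alpha>" and \<theta>: "0 < \<theta>"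
  shows "gg_power_integral \<alpha> \<theta> T = ennreal_powr T (- \<theta>) * gg_power_integral \<alpha> \<theta> 1"
proof -
  consider "T = 0" | "T = \<infinity>" | t where "0 < t" "T = ennreal t"
    by (cases T) (auto simp: ennreal_eq_0_iff le_less)
  then show ?thesis
  proof cases
    case 1
    let ?I = "gg_power_integral \<alpha> \<theta> 0"
    \<comment> \<open>The factor is chosen so that its power \<open>-\<theta>\<close> is 2. Scaling
      leaves \<open>T = 0\<close> fixed, hence \<open>?I = 2 * ?I\<close>; being positive,
      \<open>?I\<close> is infinite, in accordance with the value of \<open>ennreal_powr\<close> at
      0.\<close>
    have "?I = ennreal ((2 powr (- 1 / \<theta>)) powr (- \<theta>)) * ?I"
      using gg_power_integral_scale[OF \<alpha>, of "2 powr (- 1 / \<theta>)" \<theta> 0] by simp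
    then have "?I = ennreal 2 * ?I" using \<theta> by (simp add: powr_powr)
    then have "?I = ?I + ?I" by (simp add: mult_2)
    moreover have "?I \<noteq> 0" using gg_power_integral_pos[of 0 \<alpha> \<theta>] by simp
    ultimately have "?I = \<infinity>" by (cases ?I) (auto simp flip: ennreal_plus)
    moreover have "gg_power_integral \<alpha> \<theta> 1 \<noteq> 0" using gg_power_integral_pos[of 1 \<alpha> \<theta>] by auto
    ultimately show ?thesis using 1 \<theta> by (simp add: ennreal_powr_def ennreal_top_mult)
  next
    case 2
    have "gg_power_integral \<alpha> \<theta> T = (\<integral>\<^sup>+L. 0 \<partial>(lborel :: real measure))"
      unfolding gg_power_integral_def by (intro nn_integral_cong) (auto simp: 2 ennreal_mult_top)
    then show ?thesis using 2 \<theta> by (simp add: ennreal_powr_def)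
  next
    case 3
    then show ?thesis
      using gg_power_integral_scale[OF \<alpha>, of t \<theta> 1] \<theta> by (simp add: ennreal_powr_def)
  qed
qed

lemma borel_measurable_total_mass [measurable]:
  "total_mass \<in> borel_measurable (meas_algebra (borel :: 'y::topological_space measure))"
proof -
  have "(\<lambda>\<mu>. emeasure \<mu> UNIV) \<in> borel_measurable (meas_algebra (borel :: 'y measure))"
    by measurable
  also have "?this \<longleftrightarrow> ?thesis"
    by (intro measurable_cong) (auto simp: total_mass_def space_meas_algebra dest!: sets_eq_imp_space_eq)
  finally show ?thesis .
qed

lemma borel_measurable_ennreal_powr [measurable]: "(\<lambda>x. ennreal_powr x a) \<in> borel_measurable borel"
  unfolding ennreal_powr_def by measurable

section \<open>Tilting the stable random measure and mixing over the parameter\<close>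

locale gg_setting =
  fixes \<alpha> \<theta> K :: real and \<eta> :: "'y::polish_space measure"
  assumes \<alpha>: "0 < \<alpha>" "\<alpha> < 1" and \<theta>: "0 < \<theta>"
    and sets_\<eta> [measurable_cong]: "sets \<eta> = sets borel" and finite_\<eta>: "finite_measure \<eta>"
    and \<eta>_pos: "0 < emeasure \<eta> (space \<eta>)"
    and K: "K = measure \<eta> (space \<eta>) / \<alpha>"
begin

sublocale \<eta>: finite_measure \<eta> by (rule finite_\<eta>)

lemma space_\<eta> [simp]: "space \<eta> = UNIV"
  using sets_eq_imp_space_eq[OF sets_\<eta>] by simp

lemma K_pos: "0 < K"
  using \<eta>_pos \<alpha> by (simp add: K \<eta>.emeasure_eq_measure)

lemma emeasure_\<eta>: "emeasure \<eta> UNIV = ennreal (\<alpha> * K)"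
  using \<alpha> by (simp add: K \<eta>.emeasure_eq_measure)

abbreviation "crm b \<equiv> crm_law (gg_levy \<alpha> b) \<eta>"

abbreviation "\<Gamma>L \<equiv> gamma_law (\<theta> / \<alpha>) K"

lemma prob_space_crm: "prob_space (crm b)"
  by (rule prob_space_crm_law[OF sigma_finite_gg_levy sets_gg_levy \<eta>.sigma_finite_measure_axioms sets_\<eta>])

sublocale P0: prob_space "crm 0" by (rule prob_space_crm)

lemma space_crm: "space (crm b) = {\<mu>. sets \<mu> = sets borel}"
  using sets_eq_imp_space_eq[OF sets_crm_law[of "gg_levy \<alpha> b" \<eta>]] by (simp add: space_meas_algebra)

text \<open>The constant part \<open>b^\<alpha> / \<alpha>\<close> of the exponent integrates to
  \<open>K b^\<alpha>\<close>. It is added back before integrating, since the integral of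
  \<open>(g + b)^\<alpha>\<close> may be infinite and a difference of integrals is to be
  avoided.\<close>

lemma laplace_functional_crm:
  assumes b: "0 \<le> b" and g [measurable]: "g \<in> borel_measurable borel" and g0: "\<And>y. 0 \<le> g y"
  shows "laplace_functional (crm b) g
    = ennreal_exp_neg (ennreal (1 / \<alpha>) * (\<integral>\<^sup>+y. ennreal ((g y + b) powr \<alpha>) \<partial>\<eta>)) * ennreal (exp (K * b powr \<alpha>))"
proof -
  let ?J = "\<integral>\<^sup>+y. ennreal (((b + g y) powr \<alpha> - b powr \<alpha>) / \<alpha>) \<partial>\<eta>"
  have nonneg: "0 \<le> ((b + g y) powr \<alpha> - b powr \<alpha>) / \<alpha>" for y
    using \<alpha> b g0[of y] by (auto intro!: divide_nonneg_pos powr_mono2)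
  have "ennreal (1 / \<alpha>) * (\<integral>\<^sup>+y. ennreal ((g y + b) powr \<alpha>) \<partial>\<eta>)
      = (\<integral>\<^sup>+y. ennreal (1 / \<alpha>) * ennreal ((g y + b) powr \<alpha>) \<partial>\<eta>)"
    by (rule nn_integral_cmult[symmetric]) measurable
  also have "\<dots> = (\<integral>\<^sup>+y. ennreal (((b + g y) powr \<alpha> - b powr \<alpha>) / \<alpha>) + ennreal (b powr \<alpha> / \<alpha>) \<partial>\<eta>)"
  proof (rule nn_integral_cong)
    fix y
    show "ennreal (1 / \<alpha>) * ennreal ((g y + b) powr \<alpha>)
        = ennreal (((b + g y) powr \<alpha> - b powr \<alpha>) / \<alpha>) + ennreal (b powr \<alpha> / \<alpha>)"
      using \<alpha> nonneg[of y]
      by (subst ennreal_plus[symmetric])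
         (auto simp: diff_divide_distrib add.commute ennreal_mult[symmetric])
  qed
  also have "\<dots> = ?J + ennreal (b powr \<alpha> / \<alpha>) * emeasure \<eta> UNIV"
    by (subst nn_integral_add) auto
  also have "ennreal (b powr \<alpha> / \<alpha>) * emeasure \<eta> UNIV = ennreal (K * b powr \<alpha>)"
    using \<alpha> K_pos by (simp add: emeasure_\<eta> mult.commute flip: ennreal_mult)
  finally have "ennreal_exp_neg (ennreal (1 / \<alpha>) * (\<integral>\<^sup>+y. ennreal ((g y + b) powr \<alpha>) \<partial>\<eta>))
      = ennreal_exp_neg ?J * ennreal (exp (- (K * b powr \<alpha>)))"
    using K_pos by (simp add: ennreal_exp_neg_add ennreal_exp_neg_ennreal)
  moreover have "ennreal (exp (- (K * b powr \<alpha>))) * ennreal (exp (K * b powr \<alpha>)) = 1"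
    by (simp flip: ennreal_mult exp_add)
  moreover have "laplace_functional (crm b) g = ennreal_exp_neg ?J"
    by (simp add: laplace_functional_crm_law[OF sigma_finite_gg_levy sets_gg_levy
          \<eta>.sigma_finite_measure_axioms sets_\<eta> g g0] gg_levy_laplace_exponent[OF \<alpha> b g0])
  ultimately show ?thesis by (simp add: mult.assoc)
qed

definition tilt :: "real \<Rightarrow> 'y measure \<Rightarrow> ennreal" where
  "tilt b \<mu> = ennreal (exp (K * b powr \<alpha>)) * ennreal_exp_neg (ennreal b * total_mass \<mu>)"

lemma measurable_tilt [measurable]:
  "case_prod tilt \<in> borel_measurable (borel \<Otimes>\<^sub>M meas_algebra borel)"
  unfolding tilt_def[abs_def] by measurable

text \<open>As \<open>b T = mu(b)\<close>, exponential tilting by the total mass shifts the test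
  function by the constant \<open>b\<close>.\<close>

lemma exp_neg_add_const:
  assumes \<mu>: "sets \<mu> = sets borel" and g [measurable]: "g \<in> borel_measurable borel"
    and "\<And>y. 0 \<le> g y" "0 \<le> b"
  shows "ennreal_exp_neg (\<integral>\<^sup>+y. ennreal (g y + b) \<partial>\<mu>)
    = ennreal_exp_neg (\<integral>\<^sup>+y. ennreal (g y) \<partial>\<mu>) * ennreal_exp_neg (ennreal b * total_mass \<mu>)"
proof -
  note [measurable_cong] = \<mu>
  have "(\<integral>\<^sup>+y. ennreal (g y + b) \<partial>\<mu>) = (\<integral>\<^sup>+y. ennreal (g y) + ennreal b \<partial>\<mu>)"
    using assms by (intro nn_integral_cong) auto
  also have "\<dots> = (\<integral>\<^sup>+y. ennreal (g y) \<partial>\<mu>) + ennreal b * total_mass \<mu>"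
    by (subst nn_integral_add) (auto simp: total_mass_def)
  finally show ?thesis by (simp add: ennreal_exp_neg_add)
qed

lemma crm_eq_density:
  assumes b: "0 \<le> b"
  shows "crm b = density (crm 0) (tilt b)"
proof (rule meas_algebra_eqI_laplace_functional)
  have [measurable]: "tilt b \<in> borel_measurable (crm 0)" by measurable
  have lf: "laplace_functional (density (crm 0) (tilt b)) g = laplace_functional (crm b) g"
    if g [measurable]: "g \<in> borel_measurable borel" and g0: "\<And>y. 0 \<le> g y" for g
  proof -
    have "laplace_functional (density (crm 0) (tilt b)) g
        = (\<integral>\<^sup>+\<mu>. tilt b \<mu> * ennreal_exp_neg (\<integral>\<^sup>+y. ennreal (g y) \<partial>\<mu>) \<partial>crm 0)"
      unfolding laplace_functional_def by (rule nn_integral_density) measurable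
    also have "\<dots> = (\<integral>\<^sup>+\<mu>. ennreal (exp (K * b powr \<alpha>)) * ennreal_exp_neg (\<integral>\<^sup>+y. ennreal (g y + b) \<partial>\<mu>) \<partial>crm 0)"
      using exp_neg_add_const[OF _ g g0 b]
      by (intro nn_integral_cong) (simp add: space_crm tilt_def mult_ac)
    also have "\<dots> = ennreal (exp (K * b powr \<alpha>)) * laplace_functional (crm 0) (\<lambda>y. g y + b)"
      unfolding laplace_functional_def by (rule nn_integral_cmult) measurable
    \<comment> \<open>At parameter 0 and test function \<open>g + b\<close> the closed form contains
      the same integral of \<open>(g y + b) powr \<alpha>\<close>; the factor in front is the one
      that it lacks.\<close>
    also have "\<dots> = laplace_functional (crm b) g"
      using b g0 by (simp add: laplace_functional_crm mult.commute)
    finally show ?thesis .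
  qed
  show "prob_space (crm b)" by (rule prob_space_crm)
  \<comment> \<open>The total mass of the tilted law is its Laplace functional at 0, already known
    to agree with that of a probability measure.\<close>
  show "prob_space (density (crm 0) (tilt b))"
  proof (rule prob_spaceI)
    have "emeasure (density (crm 0) (tilt b)) (space (density (crm 0) (tilt b)))
        = laplace_functional (density (crm 0) (tilt b)) (\<lambda>_. 0)"
      by (simp add: laplace_functional_def)
    also have "\<dots> = laplace_functional (crm b) (\<lambda>_. 0)" by (rule lf) auto
    also have "\<dots> = 1"
      using prob_space.emeasure_space_1[OF prob_space_crm[of b]] by (simp add: laplace_functional_def)
    finally show "emeasure (density (crm 0) (tilt b)) (space (density (crm 0) (tilt b))) = 1" .
  qed
  show "laplace_functional (crm b) g = laplace_functional (density (crm 0) (tilt b)) g"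
    if "g \<in> borel_measurable borel" "\<And>y. 0 \<le> g y" for g
    using lf[OF that] by simp
qed simp_all

lemma gg_kernel_eq: "gg_kernel \<alpha> \<eta> L = density (crm 0) (tilt (L powr (1 / \<alpha>)))"
  unfolding gg_kernel_def by (rule crm_eq_density) simp

text \<open>Written as a density, the kernel depends on \<open>L\<close> only through an integrand
  over the fixed law \<open>crm 0\<close>, so measurability in \<open>L\<close> is that of a
  parametrised integral.\<close>

lemma measurable_gg_kernel: "gg_kernel \<alpha> \<eta> \<in> borel \<rightarrow>\<^sub>M prob_algebra (meas_algebra borel)"
proof (rule measurable_prob_algebraI)
  show prob: "prob_space (gg_kernel \<alpha> \<eta> L)" for L
    unfolding gg_kernel_def by (rule prob_space_crm)
  show "gg_kernel \<alpha> \<eta> \<in> borel \<rightarrow>\<^sub>M subprob_algebra (meas_algebra borel)"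
  proof (rule measurable_subprob_algebra)
    show "subprob_space (gg_kernel \<alpha> \<eta> L)" for L
      using prob by (rule prob_space_imp_subprob_space)
    show "sets (gg_kernel \<alpha> \<eta> L) = sets (meas_algebra borel)" for L
      by (simp add: gg_kernel_def)
    fix B :: "'y measure set" assume B [measurable]: "B \<in> sets (meas_algebra borel)"
    have "(\<lambda>L. emeasure (gg_kernel \<alpha> \<eta> L) B)
        = (\<lambda>L. \<integral>\<^sup>+\<mu>. tilt (L powr (1 / \<alpha>)) \<mu> * indicator B \<mu> \<partial>crm 0)"
      by (simp add: gg_kernel_eq emeasure_density)
    also have "\<dots> \<in> borel_measurable borel"
      by (intro P0.borel_measurable_nn_integral) measurable
    finally show "(\<lambda>L. emeasure (gg_kernel \<alpha> \<eta> L) B) \<in> borel_measurable borel" .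
  qed
qed

lemmas measurable_gg_kernel_subprob = measurable_prob_algebraD[OF measurable_gg_kernel]

lemma sets_gg_kernel [simp, measurable_cong]: "sets (gg_kernel \<alpha> \<eta> L) = sets (meas_algebra borel)"
  by (simp add: gg_kernel_def)

lemma prob_space_gg_kernel: "prob_space (gg_kernel \<alpha> \<eta> L)"
  unfolding gg_kernel_def by (rule prob_space_crm)

lemma prob_space_\<Gamma>L: "prob_space \<Gamma>L"
  using \<alpha> \<theta> K_pos by (intro prob_space_gamma_law) auto

sublocale GL: prob_space \<Gamma>L by (rule prob_space_\<Gamma>L)

lemma \<Gamma>L_in_prob_algebra: "\<Gamma>L \<in> space (prob_algebra borel)"
  by (simp add: space_prob_algebra prob_space_\<Gamma>L)

lemma laplace_functional_gg_kernel:
  assumes "g \<in> borel_measurable borel" "\<And>y. 0 \<le> g y" "0 < L"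
  shows "laplace_functional (gg_kernel \<alpha> \<eta> L) g = cond_laplace \<alpha> K \<eta> g L"
  using assms \<alpha> unfolding gg_kernel_def
  by (subst laplace_functional_crm) (auto simp: cond_laplace_def powr_powr)

definition mix_const :: ennreal where
  "mix_const = ennreal (K powr (\<theta> / \<alpha>) / Gamma (\<theta> / \<alpha>)) * gg_power_integral \<alpha> \<theta> 1"

lemma nn_integral_tilt_\<Gamma>L:
  "(\<integral>\<^sup>+L. tilt (L powr (1 / \<alpha>)) \<mu> \<partial>\<Gamma>L) = mix_const * ennreal_powr (total_mass \<mu>) (- \<theta>)"
proof -
  have "(\<integral>\<^sup>+L. tilt (L powr (1 / \<alpha>)) \<mu> \<partial>\<Gamma>L) = ennreal (K powr (\<theta> / \<alpha>) / Gamma (\<theta> / \<alpha>)) *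
    (\<integral>\<^sup>+L. (if 0 < L then ennreal (L powr (\<theta> / \<alpha> - 1) * exp (- K * L)) * tilt (L powr (1 / \<alpha>)) \<mu> else 0) \<partial>lborel)"
    using \<alpha> \<theta> by (intro nn_integral_gamma_law) (auto simp: tilt_def)
  also have "(\<integral>\<^sup>+L. (if 0 < L then ennreal (L powr (\<theta> / \<alpha> - 1) * exp (- K * L)) * tilt (L powr (1 / \<alpha>)) \<mu> else 0) \<partial>lborel)
      = gg_power_integral \<alpha> \<theta> (total_mass \<mu>)"
    unfolding gg_power_integral_def
  proof (intro nn_integral_cong if_cong refl)
    \<comment> \<open>Here the rate \<open>K\<close> matters: since
      \<open>(L powr (1 / \<alpha>)) powr \<alpha> = L\<close>, the constant in \<open>tilt\<close>
      is \<open>exp(K L)\<close> and cancels the exponential of the gamma density.\<close>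
    fix L :: real assume L: "0 < L"
    then have "ennreal (L powr (\<theta> / \<alpha> - 1) * exp (- K * L)) * ennreal (exp (K * (L powr (1 / \<alpha>)) powr \<alpha>))
        = ennreal (L powr (\<theta> / \<alpha> - 1))"
      using \<alpha> by (simp add: powr_powr mult.assoc flip: ennreal_mult exp_add)
    then show "ennreal (L powr (\<theta> / \<alpha> - 1) * exp (- K * L)) * tilt (L powr (1 / \<alpha>)) \<mu>
        = ennreal (L powr (\<theta> / \<alpha> - 1)) * ennreal_exp_neg (ennreal (L powr (1 / \<alpha>)) * total_mass \<mu>)"
      by (simp add: tilt_def mult.assoc[symmetric])
  qed
  finally show ?thesis
    by (simp add: gg_power_integral_eq[OF \<alpha>(1) \<theta>, of "total_mass \<mu>"] mix_const_def mult_ac)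
qed

lemma emeasure_mixture:
  assumes B [measurable]: "B \<in> sets (meas_algebra borel)"
  shows "emeasure (\<Gamma>L \<bind> gg_kernel \<alpha> \<eta>) B
    = (\<integral>\<^sup>+\<mu>. mix_const * ennreal_powr (total_mass \<mu>) (- \<theta>) * indicator B \<mu> \<partial>crm 0)"
proof -
  interpret pair_sigma_finite "crm 0" \<Gamma>L ..
  have "emeasure (\<Gamma>L \<bind> gg_kernel \<alpha> \<eta>) B = (\<integral>\<^sup>+L. emeasure (gg_kernel \<alpha> \<eta> L) B \<partial>\<Gamma>L)"
    using \<Gamma>L_in_prob_algebra measurable_gg_kernel B by (rule emeasure_bind_prob_algebra)
  also have "\<dots> = (\<integral>\<^sup>+L. \<integral>\<^sup>+\<mu>. tilt (L powr (1 / \<alpha>)) \<mu> * indicator B \<mu> \<partial>crm 0 \<partial>\<Gamma>L)"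
    by (simp add: gg_kernel_eq emeasure_density)
  also have "\<dots> = (\<integral>\<^sup>+\<mu>. \<integral>\<^sup>+L. tilt (L powr (1 / \<alpha>)) \<mu> * indicator B \<mu> \<partial>\<Gamma>L \<partial>crm 0)"
  proof (rule Fubini')
    have "(\<lambda>(\<mu>, L). tilt (L powr (1 / \<alpha>)) \<mu> * indicator B \<mu>) \<in> borel_measurable (meas_algebra borel \<Otimes>\<^sub>M borel)"
      unfolding tilt_def[abs_def] by measurable
    then show "(\<lambda>(\<mu>, L). tilt (L powr (1 / \<alpha>)) \<mu> * indicator B \<mu>) \<in> borel_measurable (crm 0 \<Otimes>\<^sub>M \<Gamma>L)"
      by (simp add: measurable_cong_sets[OF sets_pair_measure_cong[OF sets_crm_law sets_gamma_law] refl])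
  qed
  also have "\<dots> = (\<integral>\<^sup>+\<mu>. mix_const * ennreal_powr (total_mass \<mu>) (- \<theta>) * indicator B \<mu> \<partial>crm 0)"
  proof (rule nn_integral_cong)
    fix \<mu>
    have "(\<integral>\<^sup>+L. tilt (L powr (1 / \<alpha>)) \<mu> * indicator B \<mu> \<partial>\<Gamma>L)
        = (\<integral>\<^sup>+L. tilt (L powr (1 / \<alpha>)) \<mu> \<partial>\<Gamma>L) * indicator B \<mu>"
      by (rule nn_integral_multc) (simp add: tilt_def)
    then show "(\<integral>\<^sup>+L. tilt (L powr (1 / \<alpha>)) \<mu> * indicator B \<mu> \<partial>\<Gamma>L)
        = mix_const * ennreal_powr (total_mass \<mu>) (- \<theta>) * indicator B \<mu>"
      by (simp add: nn_integral_tilt_\<Gamma>L)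
  qed
  finally show ?thesis .
qed

lemma sets_mixture: "sets (\<Gamma>L \<bind> gg_kernel \<alpha> \<eta>) = sets (meas_algebra borel)"
  by (rule sets_bind) auto

lemma PD_law_eq_mixture: "PD_law \<alpha> \<theta> \<eta> = \<Gamma>L \<bind> gg_kernel \<alpha> \<eta>"
proof (rule measure_eqI)
  let ?I = "\<integral>\<^sup>+\<mu>. ennreal_powr (total_mass \<mu>) (- \<theta>) \<partial>crm 0"
  let ?UN = "space (meas_algebra (borel :: 'y measure))"
  have "1 = emeasure (\<Gamma>L \<bind> gg_kernel \<alpha> \<eta>) ?UN"
  proof -
    have "emeasure (\<Gamma>L \<bind> gg_kernel \<alpha> \<eta>) ?UN = (\<integral>\<^sup>+L. emeasure (gg_kernel \<alpha> \<eta> L) ?UN \<partial>\<Gamma>L)"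
      using \<Gamma>L_in_prob_algebra measurable_gg_kernel by (rule emeasure_bind_prob_algebra) simp
    also have "\<dots> = (\<integral>\<^sup>+L. 1 \<partial>\<Gamma>L)"
    proof (rule nn_integral_cong)
      fix L
      show "emeasure (gg_kernel \<alpha> \<eta> L) ?UN = 1"
        using prob_space.emeasure_space_1[OF prob_space_gg_kernel[of L]]
        unfolding sets_eq_imp_space_eq[OF sets_gg_kernel] .
    qed
    finally show ?thesis using GL.emeasure_space_1 by simp
  qed
  also have "\<dots> = (\<integral>\<^sup>+\<mu>. mix_const * ennreal_powr (total_mass \<mu>) (- \<theta>) \<partial>crm 0)"
    unfolding emeasure_mixture[OF sets.top]
    by (intro nn_integral_cong) (simp add: space_crm space_meas_algebra)
  also have "\<dots> = mix_const * ?I"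
    by (rule nn_integral_cmult) measurable
  finally have one: "mix_const * ?I = 1" by simp
  \<comment> \<open>Because \<open>0 * \<infinity> = 0\<close>, a product equal to 1 excludes both
    extreme values. Thus the normalisation in \<open>PD_law\<close> is proper and dividing by
    \<open>?I\<close> is multiplying by \<open>mix_const\<close>.\<close>
  have "?I \<noteq> 0"
  proof
    assume "?I = 0"
    then show False using one by simp
  qed
  moreover have "?I \<noteq> \<top>"
  proof
    assume "?I = \<top>"
    then show False using one by (cases "mix_const = 0") (auto simp: ennreal_mult_top)
  qed
  ultimately have I: "?I \<noteq> 0" "?I \<noteq> \<top>" by auto
  have normalize: "x / ?I = mix_const * x" for x
  proof -
    have "mix_const * x * ?I = x * (mix_const * ?I)" by (simp only: mult_ac)
    then have "x / ?I = mix_const * x * ?I / ?I" by (simp only: one mult_1_right)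
    then show ?thesis using I by (simp add: ennreal_mult_divide_eq)
  qed
  show "sets (PD_law \<alpha> \<theta> \<eta>) = sets (\<Gamma>L \<bind> gg_kernel \<alpha> \<eta>)"
    by (simp add: PD_law_def sets_mixture)
  fix B assume "B \<in> sets (PD_law \<alpha> \<theta> \<eta>)"
  then have B [measurable]: "B \<in> sets (meas_algebra borel)" by (simp add: PD_law_def)
  show "emeasure (PD_law \<alpha> \<theta> \<eta>) B = emeasure (\<Gamma>L \<bind> gg_kernel \<alpha> \<eta>) B"
    unfolding PD_law_def normalize emeasure_mixture[OF B] by (rule emeasure_density) measurable
qed

section \<open>The joint law of the gamma variable and the random measure\<close>

lemma measurable_joint_kernel [measurable]:
  "(\<lambda>L. distr (gg_kernel \<alpha> \<eta> L) (borel \<Otimes>\<^sub>M meas_algebra borel) (Pair L))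
    \<in> borel \<rightarrow>\<^sub>M prob_algebra (borel \<Otimes>\<^sub>M meas_algebra borel)"
  by (rule measurable_distr_prob_space2[OF measurable_gg_kernel]) measurable

abbreviation "joint \<equiv> joint_law \<alpha> \<theta> K \<eta>"

lemma sets_joint [simp, measurable_cong]: "sets joint = sets (borel \<Otimes>\<^sub>M meas_algebra borel)"
  unfolding joint_law_def by (rule sets_bind) auto

text \<open>Disintegration of the pair; both marginals, the formula on rectangles and the scaled
  functionals are instances.\<close>

lemma nn_integral_joint:
  assumes f [measurable]: "f \<in> borel_measurable (borel \<Otimes>\<^sub>M meas_algebra borel)"
  shows "(\<integral>\<^sup>+x. f x \<partial>joint) = (\<integral>\<^sup>+L. \<integral>\<^sup>+\<mu>. f (L, \<mu>) \<partial>gg_kernel \<alpha> \<eta> L \<partial>\<Gamma>L)"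
proof -
  have "(\<integral>\<^sup>+x. f x \<partial>joint) = (\<integral>\<^sup>+L. \<integral>\<^sup>+x. f x
      \<partial>distr (gg_kernel \<alpha> \<eta> L) (borel \<Otimes>\<^sub>M meas_algebra borel) (Pair L) \<partial>\<Gamma>L)"
    unfolding joint_law_def using measurable_prob_algebraD[OF measurable_joint_kernel]
    by (intro nn_integral_bind[OF f]) simp
  also have "\<dots> = (\<integral>\<^sup>+L. \<integral>\<^sup>+\<mu>. f (L, \<mu>) \<partial>gg_kernel \<alpha> \<eta> L \<partial>\<Gamma>L)"
    by (intro nn_integral_cong nn_integral_distr) measurable
  finally show ?thesis .
qed

lemma prob_space_joint: "prob_space joint"
proof (rule prob_spaceI)
  have "emeasure joint (space joint) = (\<integral>\<^sup>+x. 1 \<partial>joint)" by simp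
  also have "\<dots> = (\<integral>\<^sup>+L. \<integral>\<^sup>+\<mu>. 1 \<partial>gg_kernel \<alpha> \<eta> L \<partial>\<Gamma>L)" by (rule nn_integral_joint) simp
  also have "\<dots> = 1"
    using GL.emeasure_space_1 by (simp add: prob_space.emeasure_space_1[OF prob_space_gg_kernel])
  finally show "emeasure joint (space joint) = 1" .
qed

text \<open>The precise sense in which \<open>gg_kernel\<close> is the conditional law of the random
  measure given \<open>L\<close>.\<close>

lemma emeasure_joint_Times:
  assumes A [measurable]: "A \<in> sets borel" and B [measurable]: "B \<in> sets (meas_algebra borel)"
  shows "emeasure joint (A \<times> B) = (\<integral>\<^sup>+L\<in>A. emeasure (gg_kernel \<alpha> \<eta> L) B \<partial>\<Gamma>L)"
proof -
  have "emeasure joint (A \<times> B) = (\<integral>\<^sup>+x. indicator (A \<times> B) x \<partial>joint)" by simp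
  also have "\<dots> = (\<integral>\<^sup>+L. \<integral>\<^sup>+\<mu>. indicator (A \<times> B) (L, \<mu>) \<partial>gg_kernel \<alpha> \<eta> L \<partial>\<Gamma>L)"
    by (rule nn_integral_joint) simp
  also have "\<dots> = (\<integral>\<^sup>+L. \<integral>\<^sup>+\<mu>. indicator A L * indicator B \<mu> \<partial>gg_kernel \<alpha> \<eta> L \<partial>\<Gamma>L)"
    by (simp add: indicator_times)
  also have "\<dots> = (\<integral>\<^sup>+L\<in>A. emeasure (gg_kernel \<alpha> \<eta> L) B \<partial>\<Gamma>L)"
    by (simp add: nn_integral_cmult_indicator mult.commute)
  finally show ?thesis .
qed

lemma distr_joint_fst: "distr joint borel fst = \<Gamma>L"
proof (rule measure_eqI)
  fix A assume "A \<in> sets (distr joint borel fst)"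
  then have A [measurable]: "A \<in> sets borel" by simp
  have "emeasure (distr joint borel fst) A = (\<integral>\<^sup>+x. indicator A x \<partial>distr joint borel fst)" by simp
  also have "\<dots> = (\<integral>\<^sup>+x. indicator A (fst x) \<partial>joint)" by (rule nn_integral_distr) measurable
  also have "\<dots> = (\<integral>\<^sup>+L. \<integral>\<^sup>+\<mu>. indicator A (fst (L, \<mu>)) \<partial>gg_kernel \<alpha> \<eta> L \<partial>\<Gamma>L)"
    by (rule nn_integral_joint) measurable
  also have "\<dots> = emeasure \<Gamma>L A"
    by (simp add: prob_space.emeasure_space_1[OF prob_space_gg_kernel])
  finally show "emeasure (distr joint borel fst) A = emeasure \<Gamma>L A" .
qed simp

lemma distr_joint_snd: "distr joint (meas_algebra borel) snd = \<Gamma>L \<bind> gg_kernel \<alpha> \<eta>"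
proof (rule measure_eqI)
  fix B assume "B \<in> sets (distr joint (meas_algebra borel) snd)"
  then have B [measurable]: "B \<in> sets (meas_algebra borel)" by simp
  have "emeasure (distr joint (meas_algebra borel) snd) B
      = (\<integral>\<^sup>+x. indicator B x \<partial>distr joint (meas_algebra borel) snd)" by simp
  also have "\<dots> = (\<integral>\<^sup>+x. indicator B (snd x) \<partial>joint)" by (rule nn_integral_distr) measurable
  also have "\<dots> = (\<integral>\<^sup>+L. \<integral>\<^sup>+\<mu>. indicator B (snd (L, \<mu>)) \<partial>gg_kernel \<alpha> \<eta> L \<partial>\<Gamma>L)"
    by (rule nn_integral_joint) measurable
  also have "\<dots> = emeasure (\<Gamma>L \<bind> gg_kernel \<alpha> \<eta>) B"
    using emeasure_bind_prob_algebra[OF \<Gamma>L_in_prob_algebra measurable_gg_kernel B] by simp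
  finally show "emeasure (distr joint (meas_algebra borel) snd) B = emeasure (\<Gamma>L \<bind> gg_kernel \<alpha> \<eta>) B" .
qed (simp add: sets_mixture)

lemma gamma_law_exponential:
  assumes "K = 1" "\<theta> = \<alpha>"
  shows "\<Gamma>L = density lborel (exponential_density 1)"
proof -
  \<comment> \<open>The densities differ at the single point 0, where
    \<open>exponential_density 1\<close> is 1 and the gamma density is set to 0.\<close>
  have "AE x in lborel. x \<noteq> (0::real)" by (rule AE_lborel_singleton)
  then show ?thesis
    unfolding gamma_law_def using assms \<alpha>
    by (intro density_cong) (auto elim!: eventually_mono simp: exponential_density_def)
qed

lemma distr_joint_fst_exponential:
  "K = 1 \<and> \<theta> = \<alpha> \<Longrightarrow> distr joint borel fst = density lborel (exponential_density 1)"
  unfolding distr_joint_fst by (intro gamma_law_exponential) auto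

section \<open>Unconditional Laplace functionals and the scaled total mass\<close>

lemma laplace_functional_PD_law:
  assumes g [measurable]: "g \<in> borel_measurable borel" and g0: "\<And>y. 0 \<le> g y"
  shows "laplace_functional (PD_law \<alpha> \<theta> \<eta>) g = (\<integral>\<^sup>+L. cond_laplace \<alpha> K \<eta> g L \<partial>\<Gamma>L)"
proof -
  have "laplace_functional (PD_law \<alpha> \<theta> \<eta>) g = (\<integral>\<^sup>+L. laplace_functional (gg_kernel \<alpha> \<eta> L) g \<partial>\<Gamma>L)"
    unfolding PD_law_eq_mixture laplace_functional_def using measurable_gg_kernel_subprob
    by (intro nn_integral_bind) (measurable, simp)
  also have "\<dots> = (\<integral>\<^sup>+L. cond_laplace \<alpha> K \<eta> g L \<partial>\<Gamma>L)"
    by (intro nn_integral_gamma_law_cong laplace_functional_gg_kernel g g0)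
  finally show ?thesis .
qed

lemma measurable_scale [measurable]:
  "(\<lambda>(L, \<mu>). scale_measure (ennreal (L powr (1 / \<alpha>))) \<mu>)
    \<in> borel \<Otimes>\<^sub>M meas_algebra borel \<rightarrow>\<^sub>M meas_algebra (borel :: 'y measure)"
proof (rule measurable_meas_algebra)
  fix A :: "'y set" assume A [measurable]: "A \<in> sets borel"
  have "(\<lambda>x. ennreal (fst x powr (1 / \<alpha>)) * emeasure (snd x) A) \<in> borel_measurable (borel \<Otimes>\<^sub>M meas_algebra borel)"
    by measurable
  then show "(\<lambda>x. emeasure (case x of (L, \<mu>) \<Rightarrow> scale_measure (ennreal (L powr (1 / \<alpha>))) \<mu>) A)
      \<in> borel_measurable (borel \<Otimes>\<^sub>M meas_algebra borel)"
    by (simp add: split_def)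
qed (simp add: space_pair_measure space_meas_algebra split_def mem_Times_iff)

text \<open>Given \<open>L\<close>, scaling the measure is the same as scaling the test
  function.\<close>

lemma laplace_functional_scaled:
  assumes g [measurable]: "g \<in> borel_measurable borel" and g0: "\<And>y. 0 \<le> g y"
  shows "laplace_functional (distr joint (meas_algebra borel)
      (\<lambda>(L, \<mu>). scale_measure (ennreal (L powr (1 / \<alpha>))) \<mu>)) g
    = (\<integral>\<^sup>+L. cond_laplace \<alpha> K \<eta> (\<lambda>y. L powr (1 / \<alpha>) * g y) L \<partial>\<Gamma>L)"
proof -
  let ?S = "\<lambda>(L, \<mu>). scale_measure (ennreal (L powr (1 / \<alpha>))) \<mu>"
  have "laplace_functional (distr joint (meas_algebra borel) ?S) g
      = (\<integral>\<^sup>+x. ennreal_exp_neg (\<integral>\<^sup>+y. ennreal (g y) \<partial>?S x) \<partial>joint)"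
    unfolding laplace_functional_def by (rule nn_integral_distr) measurable
  also have "\<dots> = (\<integral>\<^sup>+L. \<integral>\<^sup>+\<mu>. ennreal_exp_neg (\<integral>\<^sup>+y. ennreal (g y) \<partial>?S (L, \<mu>)) \<partial>gg_kernel \<alpha> \<eta> L \<partial>\<Gamma>L)"
    by (rule nn_integral_joint) measurable
  also have "\<dots> = (\<integral>\<^sup>+L. laplace_functional (gg_kernel \<alpha> \<eta> L) (\<lambda>y. L powr (1 / \<alpha>) * g y) \<partial>\<Gamma>L)"
    unfolding laplace_functional_def
  proof (intro nn_integral_cong arg_cong[where f = ennreal_exp_neg])
    fix L and \<mu> :: "'y measure" assume "\<mu> \<in> space (gg_kernel \<alpha> \<eta> L)"
    then have [measurable_cong]: "sets \<mu> = sets borel" by (simp add: gg_kernel_def space_crm)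
    have "(\<integral>\<^sup>+y. ennreal (L powr (1 / \<alpha>) * g y) \<partial>\<mu>) = (\<integral>\<^sup>+y. ennreal (L powr (1 / \<alpha>)) * ennreal (g y) \<partial>\<mu>)"
      using g0 by (intro nn_integral_cong) (simp add: ennreal_mult)
    also have "\<dots> = ennreal (L powr (1 / \<alpha>)) * (\<integral>\<^sup>+y. ennreal (g y) \<partial>\<mu>)"
      by (rule nn_integral_cmult) measurable
    finally show "(\<integral>\<^sup>+y. ennreal (g y) \<partial>?S (L, \<mu>)) = (\<integral>\<^sup>+y. ennreal (L powr (1 / \<alpha>) * g y) \<partial>\<mu>)"
      by (simp add: nn_integral_scale_measure)
  qed
  also have "\<dots> = (\<integral>\<^sup>+L. cond_laplace \<alpha> K \<eta> (\<lambda>y. L powr (1 / \<alpha>) * g y) L \<partial>\<Gamma>L)"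
    using g0 by (intro nn_integral_gamma_law_cong laplace_functional_gg_kernel) auto
  finally show ?thesis .
qed

text \<open>Scaling \<open>g\<close> by \<open>L^(1/\<alpha>)\<close> makes the base homogeneous:
  \<open>(L^(1/\<alpha>) (g + 1))^\<alpha> = L (g + 1)^\<alpha>\<close>. The exponent becomes linear
  in \<open>L\<close>, so after \<open>exp(K L)\<close> cancels a Gamma integral of rate
  \<open>I / \<alpha>\<close> is left.\<close>

lemma nn_integral_cond_laplace_scaled:
  assumes g [measurable]: "g \<in> borel_measurable borel" and g0: "\<And>y. 0 \<le> g y"
    and H: "H = scale_measure (1 / emeasure \<eta> (space \<eta>)) \<eta>"
  shows "(\<integral>\<^sup>+L. cond_laplace \<alpha> K \<eta> (\<lambda>y. L powr (1 / \<alpha>) * g y) L \<partial>\<Gamma>L)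
    = ennreal_powr (\<integral>\<^sup>+y. ennreal ((g y + 1) powr \<alpha>) \<partial>H) (- \<theta> / \<alpha>)"
proof -
  let ?a = "\<theta> / \<alpha>"
  define I where "I = (\<integral>\<^sup>+y. ennreal ((g y + 1) powr \<alpha>) \<partial>\<eta>)"
  have a: "0 < ?a" using \<alpha> \<theta> by simp
  have G: "0 < Gamma ?a" using a by (rule Gamma_real_pos)
  have IH: "(\<integral>\<^sup>+y. ennreal ((g y + 1) powr \<alpha>) \<partial>H) = I / ennreal (\<alpha> * K)"
    unfolding H I_def
    by (subst nn_integral_scale_measure)
      (auto simp: emeasure_\<eta> ennreal_divide_times)
  have "(\<integral>\<^sup>+L. cond_laplace \<alpha> K \<eta> (\<lambda>y. L powr (1 / \<alpha>) * g y) L \<partial>\<Gamma>L)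
      = (\<integral>\<^sup>+L. ennreal_exp_neg (ennreal (L / \<alpha>) * I) * ennreal (exp (K * L)) \<partial>\<Gamma>L)"
  proof (rule nn_integral_gamma_law_cong)
    fix L :: real assume L: "0 < L"
    have "(L powr (1 / \<alpha>) * g y + L powr (1 / \<alpha>)) powr \<alpha> = L * (g y + 1) powr \<alpha>" for y
    proof -
      have "L powr (1 / \<alpha>) * g y + L powr (1 / \<alpha>) = L powr (1 / \<alpha>) * (g y + 1)"
        by (simp add: algebra_simps)
      then show ?thesis using L \<alpha> g0[of y] by (simp add: powr_mult powr_powr)
    qed
    then have "(\<integral>\<^sup>+y. ennreal ((L powr (1 / \<alpha>) * g y + L powr (1 / \<alpha>)) powr \<alpha>) \<partial>\<eta>)
        = (\<integral>\<^sup>+y. ennreal L * ennreal ((g y + 1) powr \<alpha>) \<partial>\<eta>)"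
      using L by (simp add: ennreal_mult)
    also have "\<dots> = ennreal L * I"
      unfolding I_def by (rule nn_integral_cmult) measurable
    finally show "cond_laplace \<alpha> K \<eta> (\<lambda>y. L powr (1 / \<alpha>) * g y) L
        = ennreal_exp_neg (ennreal (L / \<alpha>) * I) * ennreal (exp (K * L))"
      using L \<alpha> by (simp add: cond_laplace_def mult.assoc[symmetric] ennreal_mult[symmetric])
  qed
  also have "\<dots> = ennreal (K powr ?a / Gamma ?a) * (\<integral>\<^sup>+L. (if 0 < L
      then ennreal (L powr (?a - 1)) * ennreal_exp_neg (ennreal (L / \<alpha>) * I) else 0) \<partial>lborel)"
  proof (subst nn_integral_gamma_law[OF a])
    have e: "ennreal (L powr (?a - 1) * exp (- K * L)) * (x * ennreal (exp (K * L)))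
        = ennreal (L powr (?a - 1)) * x" for L x
    proof -
      have "ennreal (L powr (?a - 1) * exp (- K * L)) * ennreal (exp (K * L)) = ennreal (L powr (?a - 1))"
        by (simp add: mult.assoc flip: ennreal_mult exp_add)
      then show ?thesis by (simp add: mult.left_commute[of _ x] mult.commute[of _ x])
    qed
    show "ennreal (K powr ?a / Gamma ?a) * (\<integral>\<^sup>+L. (if 0 < L then ennreal (L powr (?a - 1) * exp (- K * L))
        * (ennreal_exp_neg (ennreal (L / \<alpha>) * I) * ennreal (exp (K * L))) else 0) \<partial>lborel)
      = ennreal (K powr ?a / Gamma ?a) * (\<integral>\<^sup>+L. (if 0 < L
        then ennreal (L powr (?a - 1)) * ennreal_exp_neg (ennreal (L / \<alpha>) * I) else 0) \<partial>lborel)"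
      by (simp only: e)
  qed simp
  also have "\<dots> = ennreal_powr (I / ennreal (\<alpha> * K)) (- \<theta> / \<alpha>)"
  proof (cases "I = \<infinity>")
    case True
    have "(\<integral>\<^sup>+L. (if 0 < L then ennreal (L powr (?a - 1)) * ennreal_exp_neg (ennreal (L / \<alpha>) * I) else 0) \<partial>lborel)
        = (\<integral>\<^sup>+L. 0 \<partial>(lborel :: real measure))"
      using \<alpha> by (intro nn_integral_cong) (auto simp: True ennreal_mult_top)
    moreover have "I / ennreal (\<alpha> * K) = \<infinity>"
      using True by (simp add: ennreal_top_divide)
    ultimately show ?thesis using \<alpha> \<theta> by (simp add: ennreal_powr_def)
  next
    case False
    \<comment> \<open>The lower bound \<open>g + 1 \<ge> 1\<close> makes the rate of the Gamma
      integral positive.\<close>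
    have "ennreal (\<alpha> * K) = (\<integral>\<^sup>+y. 1 \<partial>\<eta>)" by (simp add: emeasure_\<eta>)
    also have "\<dots> \<le> I"
      unfolding I_def using g0 \<alpha> by (intro nn_integral_mono) (auto intro!: ge_one_powr_ge_zero)
    finally have le: "ennreal (\<alpha> * K) \<le> I" .
    obtain r where r: "I = ennreal r" "0 \<le> r"
      using False by (cases I) auto
    have rpos: "0 < r"
      using le r \<alpha> K_pos by (auto intro: less_le_trans[of 0 "\<alpha> * K"])
    have "(\<integral>\<^sup>+L. (if 0 < L then ennreal (L powr (?a - 1)) * ennreal_exp_neg (ennreal (L / \<alpha>) * I) else 0) \<partial>lborel)
        = (\<integral>\<^sup>+L. (if 0 < L then ennreal (L powr (?a - 1) * exp (- (r / \<alpha> * L))) else 0) \<partial>lborel)"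
      using r \<alpha>
      by (intro nn_integral_cong) (auto simp: ennreal_exp_neg_ennreal mult.commute simp flip: ennreal_mult)
    also have "\<dots> = ennreal (Gamma ?a * (r / \<alpha>) powr (- ?a))"
      using a rpos \<alpha> by (intro nn_integral_powr_exp) auto
    finally have "ennreal (K powr ?a / Gamma ?a) * (\<integral>\<^sup>+L. (if 0 < L
        then ennreal (L powr (?a - 1)) * ennreal_exp_neg (ennreal (L / \<alpha>) * I) else 0) \<partial>lborel)
      = ennreal (K powr ?a * (r / \<alpha>) powr (- ?a))"
      using G by (simp flip: ennreal_mult)
    \<comment> \<open>Since \<open>\<alpha> * K\<close> is the mass of \<open>\<eta>\<close>, the
      quotient is the mean of \<open>(g + 1)^\<alpha>\<close> under the normalised measure
      \<open>H\<close>.\<close>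
    also have "K powr ?a * (r / \<alpha>) powr (- ?a) = (r / (\<alpha> * K)) powr (- \<theta> / \<alpha>)"
      using rpos \<alpha> K_pos by (simp add: powr_divide powr_mult powr_minus field_simps)
    also have "ennreal ((r / (\<alpha> * K)) powr (- \<theta> / \<alpha>)) = ennreal_powr (I / ennreal (\<alpha> * K)) (- \<theta> / \<alpha>)"
      using rpos \<alpha> \<theta> K_pos by (simp add: r divide_ennreal ennreal_powr_def)
    finally show ?thesis .
  qed
  finally show ?thesis by (simp only: IH)
qed

text \<open>Constant test functions \<open>n\<close> suffice: as \<open>H\<close> has mass 1, the
  transform at \<open>n\<close> is \<open>(n + 1)^(-\<theta>)\<close>, which is that of the gamma
  law of shape \<open>\<theta>\<close> and rate 1.\<close>

lemma distr_scaled_total_mass: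
  "distr joint borel (\<lambda>(L, \<mu>). L powr (1 / \<alpha>) * measure \<mu> (space \<mu>)) = gamma_law \<theta> 1"
proof -
  interpret J: prob_space joint by (rule prob_space_joint)
  interpret G1: prob_space "gamma_law \<theta> 1" using \<theta> by (intro prob_space_gamma_law) auto
  \<comment> \<open>The comparison is made in \<open>ennreal\<close>, where the transform determines
    the law. \<open>measure\<close> assigns 0 to an infinite mass just as \<open>enn2real\<close>
    does, so the real variable is \<open>enn2real\<close> of \<open>Z\<close>.\<close>
  define Z where "Z = (\<lambda>(L, \<mu> :: 'y measure). ennreal (L powr (1 / \<alpha>)) * total_mass \<mu>)"
  have Z [measurable]: "Z \<in> borel_measurable (borel \<Otimes>\<^sub>M meas_algebra borel)"
    unfolding Z_def by measurable
  define H where "H = scale_measure (1 / emeasure \<eta> (space \<eta>)) \<eta>"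
  have H1: "emeasure H UNIV = 1"
    using \<alpha> K_pos by (simp add: H_def emeasure_\<eta> ennreal_divide_times ennreal_divide_self)
  have "distr joint borel Z = distr (gamma_law \<theta> 1) borel ennreal"
  proof (rule prob_eq_laplace_nat)
    show "prob_space (distr joint borel Z)" by (rule J.prob_space_distr) measurable
    show "prob_space (distr (gamma_law \<theta> 1) borel ennreal)" by (rule G1.prob_space_distr) measurable
    fix n :: nat
    have "(\<integral>\<^sup>+z. ennreal_exp_neg (of_nat n * z) \<partial>distr joint borel Z)
        = (\<integral>\<^sup>+x. ennreal_exp_neg (of_nat n * Z x) \<partial>joint)"
      by (rule nn_integral_distr) measurable
    also have "\<dots> = (\<integral>\<^sup>+L. \<integral>\<^sup>+\<mu>. ennreal_exp_neg (of_nat n * Z (L, \<mu>)) \<partial>gg_kernel \<alpha> \<eta> L \<partial>\<Gamma>L)"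
      by (rule nn_integral_joint) measurable
    also have "\<dots> = (\<integral>\<^sup>+L. laplace_functional (gg_kernel \<alpha> \<eta> L) (\<lambda>y. L powr (1 / \<alpha>) * real n) \<partial>\<Gamma>L)"
      unfolding laplace_functional_def
      by (intro nn_integral_cong arg_cong[where f = ennreal_exp_neg])
        (simp add: Z_def total_mass_def ennreal_mult ennreal_of_nat_eq_real_of_nat mult_ac)
    also have "\<dots> = (\<integral>\<^sup>+L. cond_laplace \<alpha> K \<eta> (\<lambda>y. L powr (1 / \<alpha>) * real n) L \<partial>\<Gamma>L)"
      by (intro nn_integral_gamma_law_cong laplace_functional_gg_kernel) auto
    also have "\<dots> = ennreal_powr (\<integral>\<^sup>+y. ennreal ((real n + 1) powr \<alpha>) \<partial>H) (- \<theta> / \<alpha>)"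
      by (rule nn_integral_cond_laplace_scaled[OF _ _ H_def]) auto
    also have "\<dots> = ennreal ((real n + 1) powr (- \<theta>))"
    proof -
      have "(\<integral>\<^sup>+y. ennreal ((real n + 1) powr \<alpha>) \<partial>H) = ennreal ((real n + 1) powr \<alpha>)"
        using H1 by (simp add: H_def space_scale_measure)
      then show ?thesis using \<alpha> \<theta> by (simp add: ennreal_powr_def powr_powr)
    qed
    also have "\<dots> = (\<integral>\<^sup>+x. ennreal_exp_neg (of_nat n * ennreal x) \<partial>gamma_law \<theta> 1)"
    proof -
      have "(\<integral>\<^sup>+x. ennreal_exp_neg (of_nat n * ennreal x) \<partial>gamma_law \<theta> 1)
          = ennreal (1 / Gamma \<theta>) * (\<integral>\<^sup>+x. (if 0 < x then ennreal (x powr (\<theta> - 1) * exp (- 1 * x))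
              * ennreal_exp_neg (of_nat n * ennreal x) else 0) \<partial>lborel)"
        using \<theta> by (subst nn_integral_gamma_law) auto
      also have "(\<integral>\<^sup>+x. (if 0 < x then ennreal (x powr (\<theta> - 1) * exp (- 1 * x))
              * ennreal_exp_neg (of_nat n * ennreal x) else 0) \<partial>lborel)
          = (\<integral>\<^sup>+x. (if 0 < x then ennreal (x powr (\<theta> - 1) * exp (- ((real n + 1) * x))) else 0) \<partial>lborel)"
      proof (intro nn_integral_cong if_cong refl)
        fix x :: real assume x: "0 < x"
        have "ennreal_exp_neg (of_nat n * ennreal x) = ennreal (exp (- (real n * x)))"
          using x by (simp add: ennreal_of_nat_eq_real_of_nat ennreal_exp_neg_ennreal flip: ennreal_mult)
        then show "ennreal (x powr (\<theta> - 1) * exp (- 1 * x)) * ennreal_exp_neg (of_nat n * ennreal x)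
            = ennreal (x powr (\<theta> - 1) * exp (- ((real n + 1) * x)))"
          by (simp add: algebra_simps exp_add[symmetric] flip: ennreal_mult)
      qed
      also have "\<dots> = ennreal (Gamma \<theta> * (real n + 1) powr (- \<theta>))"
        using \<theta> by (intro nn_integral_powr_exp) auto
      finally show ?thesis
        using Gamma_real_pos[OF \<theta>] by (simp flip: ennreal_mult)
    qed
    also have "\<dots> = (\<integral>\<^sup>+z. ennreal_exp_neg (of_nat n * z) \<partial>distr (gamma_law \<theta> 1) borel ennreal)"
      by (rule nn_integral_distr[symmetric]) measurable
    finally show "(\<integral>\<^sup>+z. ennreal_exp_neg (of_nat n * z) \<partial>distr joint borel Z)
        = (\<integral>\<^sup>+z. ennreal_exp_neg (of_nat n * z) \<partial>distr (gamma_law \<theta> 1) borel ennreal)" .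
  qed simp_all
  then have eq: "distr (distr joint borel Z) borel enn2real
      = distr (distr (gamma_law \<theta> 1) borel ennreal) borel enn2real" by simp
  have "distr joint borel (\<lambda>(L, \<mu>). L powr (1 / \<alpha>) * measure \<mu> (space \<mu>))
      = distr joint borel (enn2real \<circ> Z)"
    by (intro distr_cong refl) (auto simp: Z_def enn2real_mult total_mass_def measure_def)
  also have "\<dots> = distr (distr (gamma_law \<theta> 1) borel ennreal) borel enn2real"
    unfolding eq[symmetric] by (rule distr_distr[symmetric]) measurable
  also have "\<dots> = distr (gamma_law \<theta> 1) borel (enn2real \<circ> ennreal)"
    by (rule distr_distr) measurable
  \<comment> \<open>\<open>enn2real\<close> undoes \<open>ennreal\<close> only on nonnegative reals,
    which is enough almost surely under the gamma law.\<close>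
  also have "\<dots> = distr (gamma_law \<theta> 1) (gamma_law \<theta> 1) (\<lambda>x. x)"
    using AE_gamma_law[of \<theta> 1] by (intro distr_cong_AE) (auto elim!: eventually_mono)
  also have "\<dots> = gamma_law \<theta> 1" by (rule distr_id)
  finally show ?thesis .
qed

end

theorem proposition5p3:
  fixes \<alpha> \<theta> K :: real and \<eta> H :: "'y::polish_space measure"
  assumes "0 < \<alpha>" "\<alpha> < 1" "0 < \<theta>"
    and "sets \<eta> = sets borel" "finite_measure \<eta>" "nonatomic \<eta>" "0 < emeasure \<eta> (space \<eta>)"
    and "H = scale_measure (1 / emeasure \<eta> (space \<eta>)) \<eta>"
    and "K = measure \<eta> (space \<eta>) / \<alpha>"
  shows
    \<comment> \<open>The first eight conjuncts are (i), the next two (ii), the last one (iii).\<close>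
    "(gg_kernel \<alpha> \<eta> \<in> borel \<rightarrow>\<^sub>M prob_algebra (meas_algebra borel)) \<and>
     (PD_law \<alpha> \<theta> \<eta> = gamma_law (\<theta> / \<alpha>) K \<bind> gg_kernel \<alpha> \<eta>) \<and>
     (distr (joint_law \<alpha> \<theta> K \<eta>) (meas_algebra borel) snd = PD_law \<alpha> \<theta> \<eta>) \<and>
     (distr (joint_law \<alpha> \<theta> K \<eta>) borel fst = gamma_law (\<theta> / \<alpha>) K) \<and>
     (\<forall>A \<in> sets borel. \<forall>B \<in> sets (meas_algebra borel).
       emeasure (joint_law \<alpha> \<theta> K \<eta>) (A \<times> B)
         = (\<integral>\<^sup>+ L \<in> A. emeasure (gg_kernel \<alpha> \<eta> L) B \<partial>gamma_law (\<theta> / \<alpha>) K)) \<and>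
     (K = 1 \<and> \<theta> = \<alpha> \<longrightarrow>
       distr (joint_law \<alpha> \<theta> K \<eta>) borel fst = density lborel (exponential_density 1)) \<and>
     (\<forall>g \<in> borel_measurable borel. (\<forall>y. 0 \<le> g y) \<longrightarrow>
       laplace_functional (PD_law \<alpha> \<theta> \<eta>) g
         = (\<integral>\<^sup>+ L. cond_laplace \<alpha> K \<eta> g L \<partial>gamma_law (\<theta> / \<alpha>) K)) \<and>
     (\<forall>g \<in> borel_measurable borel. (\<forall>y. 0 \<le> g y) \<longrightarrow>
       (\<forall>L>0. laplace_functional (gg_kernel \<alpha> \<eta> L) g = cond_laplace \<alpha> K \<eta> g L)) \<and>
     (\<forall>g \<in> borel_measurable borel. (\<forall>y. 0 \<le> g y) \<longrightarrow>
       laplace_functional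
         (distr (joint_law \<alpha> \<theta> K \<eta>) (meas_algebra borel)
            (\<lambda>(L, \<mu>). scale_measure (ennreal (L powr (1 / \<alpha>))) \<mu>)) g
         = (\<integral>\<^sup>+ L. cond_laplace \<alpha> K \<eta> (\<lambda>y. L powr (1 / \<alpha>) * g y) L \<partial>gamma_law (\<theta> / \<alpha>) K)) \<and>
     (\<forall>g \<in> borel_measurable borel. (\<forall>y. 0 \<le> g y) \<longrightarrow>
       (\<integral>\<^sup>+ L. cond_laplace \<alpha> K \<eta> (\<lambda>y. L powr (1 / \<alpha>) * g y) L \<partial>gamma_law (\<theta> / \<alpha>) K)
         = ennreal_powr (\<integral>\<^sup>+ y. ennreal ((g y + 1) powr \<alpha>) \<partial>H) (- \<theta> / \<alpha>)) \<and>
     (distr (joint_law \<alpha> \<theta> K \<eta>) borel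
       (\<lambda>(L, \<mu>). L powr (1 / \<alpha>) * measure \<mu> (space \<mu>)) = gamma_law \<theta> 1)"
proof -
  interpret gg_setting \<alpha> \<theta> K \<eta> by (rule gg_setting.intro) (fact assms)+
  show ?thesis
    by (intro conjI ballI impI allI measurable_gg_kernel PD_law_eq_mixture distr_joint_fst
        distr_joint_fst_exponential distr_joint_snd[folded PD_law_eq_mixture] emeasure_joint_Times
        laplace_functional_PD_law laplace_functional_gg_kernel laplace_functional_scaled
        nn_integral_cond_laplace_scaled[OF _ _ assms(8)] distr_scaled_total_mass)
      auto
qed

end
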